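(* Let $G\le\operatorname{Aut}(T_X)$ be a countable, perfect, self-similar subgroup that satisfies property H. For every $\omega\in\mathcal{S}$ the family of groups $(\Gamma_G^{\{\omega,\omega'\}})_{\omega'\in\mathcal{S}}$ contains uncountably many distinct isomorphism types.
   Context: Let $X$ be a non-empty finite set with a fixed element $o\in X$ and $X^+=X\setminus\{o\}$. $X^*$ is the set of finite words over $X$; $T_X$ is the rooted tree with vertex set $X^*$, root the empty word, and edges joining $w$ to $wx$ ($w\in X^*$, $x\in X$); level $\ell$ is $X^\ell$. $\operatorname{Aut}(T_X)$ is the group of root-fixing graph automorphisms. For $\alpha\in\operatorname{Aut}(T_X)$, $\sigma_\alpha\in\operatorname{Sym}(X)$ is the induced permutation of level 1, and for $x\in X$ the state $\alpha_x\in\operatorname{Aut}(T_X)$ is defined by $\alpha(xw)=\sigma_\alpha(x)\alpha_x(w)$ for all $w\in X^*$. A subgroup $G\le\operatorname{Aut}(T_X)$ is self-similar if $g_x\in G$ for all $g\in G,x\in X$. It has property H if it acts transitively on $X$ and for all $x\ne y$ in $X$ there is $g\in G$ with $g(x)=x$ and $g(y)\ne y$. $\mathcal{S}$ is the set of infinite sequences $\omega=(\omega_k)_{k\ge1}$ over $X^+$; $L(\omega_1,\omega_2,\dots)=(\omega_2,\omega_3,\dots)$. For $\alpha\in\operatorname{Aut}(T_X)$ and $\omega\in\mathcal{S}$, $\widetilde{\alpha}^{\omega}\in\operatorname{Aut}(T_X)$ fixes level 1 pointwise and is given recursively by its states: $\widetilde{\alpha}^{L(\omega)}$ at $o$, $\alpha$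 at $\omega_1$, and $\operatorname{id}$ at every other $x\in X$. For non-empty $\Omega\subseteq\mathcal{S}$, $\Gamma_G^{\Omega}$ is the subgroup of $\operatorname{Aut}(T_X)$ generated by $G$ and all $\widetilde{g}^{\omega}$ with $g\in G,\omega\in\Omega$. *)

theory Defs
  imports "HOL-Algebra.Algebra" "HOL-Library.Countable_Set"
begin

text \<open>
  The alphabet \<open>X\<close> is a type of class \<^class>\<open>finite\<close>, so that \<open>X\<^sup>*\<close> is the type of lists over it;
  the distinguished element \<open>o\<close> is the parameter \<open>x0\<close> (the letter \<open>o\<close> is reserved for composition).
\<close>

section \<open>The rooted tree and its automorphism group\<close>

definition tree_adj :: "'a list \<Rightarrow> 'a list \<Rightarrow> bool" where
  "tree_adj u v \<longleftrightarrow> (\<exists>x. v = u @ [x] \<or> u = v @ [x])"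

definition Aut_T :: "('a list \<Rightarrow> 'a list) monoid" where
  "Aut_T = \<lparr>carrier = {\<alpha>. bij \<alpha> \<and> (\<forall>u v. tree_adj (\<alpha> u) (\<alpha> v) \<longleftrightarrow> tree_adj u v) \<and> \<alpha> [] = []},
            monoid.mult = (\<circ>), one = id\<rparr>"

text \<open>
  For an automorphism \<open>\<alpha>\<close>, \<open>\<sigma>\<^sub>\<alpha> = root_perm \<alpha>\<close> and \<open>\<alpha>\<^sub>x = state \<alpha> x\<close>.
  The defining equation \<open>\<alpha>(xw) = \<sigma>\<^sub>\<alpha>(x) \<alpha>\<^sub>x(w)\<close> is \<open>Aut_T_Cons\<close> below.
\<close>

definition root_perm :: "('a list \<Rightarrow> 'a list) \<Rightarrow> 'a \<Rightarrow> 'a" where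
  "root_perm \<alpha> x = hd (\<alpha> [x])"

definition state :: "('a list \<Rightarrow> 'a list) \<Rightarrow> 'a \<Rightarrow> 'a list \<Rightarrow> 'a list" where
  "state \<alpha> x w = tl (\<alpha> (x # w))"

definition self_similar :: "('a list \<Rightarrow> 'a list) set \<Rightarrow> bool" where
  "self_similar G \<longleftrightarrow> (\<forall>g\<in>G. \<forall>x. state g x \<in> G)"

definition property_H :: "('a list \<Rightarrow> 'a list) set \<Rightarrow> bool" where
  "property_H G \<longleftrightarrow>
     (\<forall>x y. \<exists>g\<in>G. root_perm g x = y) \<and>
     (\<forall>x y. x \<noteq> y \<longrightarrow> (\<exists>g\<in>G. root_perm g x = x \<and> root_perm g y \<noteq> y))"

definition perfect_subgroup :: "('a, 'b) monoid_scheme \<Rightarrow> 'a set \<Rightarrow> bool" where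
  "perfect_subgroup A G \<longleftrightarrow> derived A G = G"

section \<open>The groups \<open>\<Gamma>\<close>\<close>

text \<open>Sequences are indexed from 0, so that \<open>\<omega> 0\<close> is the first entry and \<open>L \<omega> = \<omega> \<circ> Suc\<close>.\<close>

definition seqs :: "'a \<Rightarrow> (nat \<Rightarrow> 'a) set" where
  "seqs x0 = {\<omega>. \<forall>k. \<omega> k \<noteq> x0}"

fun tilde :: "'a \<Rightarrow> ('a list \<Rightarrow> 'a list) \<Rightarrow> (nat \<Rightarrow> 'a) \<Rightarrow> 'a list \<Rightarrow> 'a list" where
  "tilde x0 \<alpha> \<omega> [] = []"
| "tilde x0 \<alpha> \<omega> (x # w) =
     x # (if x = x0 then tilde x0 \<alpha> (\<omega> \<circ> Suc) w else if x = \<omega> 0 then \<alpha> w else w)"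

definition Gamma ::
  "'a \<Rightarrow> ('a list \<Rightarrow> 'a list) set \<Rightarrow> (nat \<Rightarrow> 'a) set \<Rightarrow> ('a list \<Rightarrow> 'a list) monoid" where
  "Gamma x0 G \<Omega> = subgroup_generated Aut_T (G \<union> {tilde x0 g \<omega> | g \<omega>. g \<in> G \<and> \<omega> \<in> \<Omega>})"

definition iso_types :: "('a, 'b) monoid_scheme set \<Rightarrow> ('a, 'b) monoid_scheme set set" where
  "iso_types F = F // {(H, K). H \<in> F \<and> K \<in> F \<and> H \<cong> K}"

section \<open>Well-definedness\<close>

lemma Aut_T_tree_adj: "\<alpha> \<in> carrier Aut_T \<Longrightarrow> tree_adj (\<alpha> u) (\<alpha> v) \<longleftrightarrow> tree_adj u v"
  by (simp add: Aut_T_def)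

lemma Aut_T_snoc:
  assumes "\<alpha> \<in> carrier Aut_T"
  shows "\<exists>y. \<alpha> (w @ [x]) = \<alpha> w @ [y]"
proof (induction w arbitrary: x rule: rev_induct)
  case Nil
  have "tree_adj [] [x]" by (simp add: tree_adj_def)
  then have "tree_adj (\<alpha> []) (\<alpha> [x])"
    by (simp only: Aut_T_tree_adj[OF assms])
  moreover have "\<alpha> [] = []" using assms by (simp add: Aut_T_def)
  ultimately show ?case by (simp add: tree_adj_def)
next
  case (snoc y w)
  have inj: "inj \<alpha>" using assms by (auto simp: Aut_T_def bij_def)
  have "tree_adj (w @ [y]) ((w @ [y]) @ [x])"
    by (simp add: tree_adj_def)
  then have "tree_adj (\<alpha> (w @ [y])) (\<alpha> ((w @ [y]) @ [x]))"
    using assms by (simp add: Aut_T_def)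
  then obtain z where z: "\<alpha> ((w @ [y]) @ [x]) = \<alpha> (w @ [y]) @ [z] \<or>
      \<alpha> (w @ [y]) = \<alpha> ((w @ [y]) @ [x]) @ [z]"
    by (auto simp: tree_adj_def)
  obtain z' where z': "\<alpha> (w @ [y]) = \<alpha> w @ [z']" using snoc by blast
  have "\<alpha> (w @ [y]) \<noteq> \<alpha> ((w @ [y]) @ [x]) @ [z]"
  proof
    assume "\<alpha> (w @ [y]) = \<alpha> ((w @ [y]) @ [x]) @ [z]"
    with z' have "\<alpha> w = \<alpha> ((w @ [y]) @ [x])" by simp
    then have "w = (w @ [y]) @ [x]" by (rule injD[OF inj])
    then show False by simp
  qed
  with z show ?case by blast
qed

lemma Aut_TI:
  assumes "bij \<alpha>" "\<alpha> [] = []" "\<And>w x. \<exists>y. \<alpha> (w @ [x]) = \<alpha> w @ [y]"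
  shows "\<alpha> \<in> carrier Aut_T"
proof -
  have inj: "inj \<alpha>" using assms(1) by (simp add: bij_def)
  have child: "\<exists>x. v = u @ [x]" if h: "\<alpha> v = \<alpha> u @ [x]" for u v x
  proof (cases v rule: rev_cases)
    case Nil
    then show ?thesis using h assms(2) by simp
  next
    case (snoc w y)
    obtain z where "\<alpha> v = \<alpha> w @ [z]" using assms(3) snoc by blast
    with h have "\<alpha> w = \<alpha> u" by simp
    then have "w = u" by (rule injD[OF inj])
    then show ?thesis using snoc by blast
  qed
  have "tree_adj (\<alpha> u) (\<alpha> v) \<longleftrightarrow> tree_adj u v" for u v
  proof
    assume "tree_adj (\<alpha> u) (\<alpha> v)"
    then show "tree_adj u v" unfolding tree_adj_def using child by blast
  next
    assume "tree_adj u v"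
    then show "tree_adj (\<alpha> u) (\<alpha> v)" unfolding tree_adj_def using assms(3) by blast
  qed
  then show ?thesis using assms by (simp add: Aut_T_def)
qed

lemma Aut_T_append:
  assumes "\<alpha> \<in> carrier Aut_T"
  shows "\<exists>z. \<alpha> (u @ w) = \<alpha> u @ z \<and> length z = length w"
proof (induction w rule: rev_induct)
  case (snoc x w)
  then obtain z where "\<alpha> (u @ w) = \<alpha> u @ z" "length z = length w" by blast
  moreover obtain y where "\<alpha> ((u @ w) @ [x]) = \<alpha> (u @ w) @ [y]"
    using Aut_T_snoc[OF assms] by blast
  ultimately show ?case by simp
qed simp

lemma Aut_T_Cons:
  assumes "\<alpha> \<in> carrier Aut_T"
  shows "\<alpha> (x # w) = root_perm \<alpha> x # state \<alpha> x w"
proof -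
  have Nil: "\<alpha> [] = []" using assms by (simp add: Aut_T_def)
  obtain y where y: "\<alpha> [x] = [y]" using Aut_T_snoc[OF assms, of "[]" x] Nil by auto
  obtain z where "\<alpha> ([x] @ w) = \<alpha> [x] @ z" using Aut_T_append[OF assms] by blast
  with y show ?thesis by (simp add: root_perm_def state_def)
qed

lemma Aut_T_inv_into:
  assumes "\<alpha> \<in> carrier Aut_T"
  shows "inv_into UNIV \<alpha> \<in> carrier Aut_T"
proof -
  have b: "bij \<alpha>" and n: "\<alpha> [] = []"
    and adj: "\<And>u v. tree_adj (\<alpha> u) (\<alpha> v) \<longleftrightarrow> tree_adj u v"
    using assms by (auto simp: Aut_T_def)
  have "tree_adj (inv_into UNIV \<alpha> u) (inv_into UNIV \<alpha> v) \<longleftrightarrow> tree_adj u v" for u v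
    using adj[of "inv_into UNIV \<alpha> u" "inv_into UNIV \<alpha> v"] b
    by (simp add: bij_is_surj surj_f_inv_f)
  moreover have "inv_into UNIV \<alpha> [] = []" using b n by (metis bij_inv_eq_iff)
  ultimately show ?thesis using bij_imp_bij_inv[OF b] by (simp add: Aut_T_def)
qed

lemma group_Aut_T: "group (Aut_T :: ('a list \<Rightarrow> 'a list) monoid)"
proof (rule groupI)
  fix \<alpha> :: "'a list \<Rightarrow> 'a list"
  assume a: "\<alpha> \<in> carrier Aut_T"
  then have "inv_into UNIV \<alpha> \<circ> \<alpha> = id" by (simp add: Aut_T_def bij_is_inj)
  then have "inv_into UNIV \<alpha> \<otimes>\<^bsub>Aut_T\<^esub> \<alpha> = \<one>\<^bsub>Aut_T\<^esub>" by (simp add: Aut_T_def)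
  then show "\<exists>\<beta>\<in>carrier Aut_T. \<beta> \<otimes>\<^bsub>Aut_T\<^esub> \<alpha> = \<one>\<^bsub>Aut_T\<^esub>"
    using Aut_T_inv_into[OF a] by blast
qed (auto simp: Aut_T_def intro: bij_comp)

lemma state_in_Aut_T:
  assumes "\<alpha> \<in> carrier Aut_T"
  shows "state \<alpha> x \<in> carrier Aut_T"
proof (rule Aut_TI)
  note C = Aut_T_Cons[OF assms]
  have b: "bij \<alpha>" and n: "\<alpha> [] = []" using assms by (auto simp: Aut_T_def)
  show "state \<alpha> x [] = []"
    using Aut_T_append[OF assms, of "[]" "[x]"] n by (auto simp: state_def length_Suc_conv)
  show "\<exists>y. state \<alpha> x (w @ [z]) = state \<alpha> x w @ [y]" for w z
    using Aut_T_snoc[OF assms, of "x # w" z] C[of x "w @ [z]"] C[of x w] by auto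
  have i: "inj (state \<alpha> x)"
  proof (rule injI)
    fix u v assume "state \<alpha> x u = state \<alpha> x v"
    then have "\<alpha> (x # u) = \<alpha> (x # v)" using C[of x u] C[of x v] by simp
    then show "u = v" using injD[OF bij_is_inj[OF b]] by blast
  qed
  have "\<exists>u. v = state \<alpha> x u" for v
  proof -
    obtain u where u: "\<alpha> u = root_perm \<alpha> x # v" using bij_is_surj[OF b] by (metis surjD)
    then obtain y t where t: "u = y # t" using n by (cases u) auto
    then have "root_perm \<alpha> y = root_perm \<alpha> x" and v: "v = state \<alpha> y t" using u C[of y t] by auto
    moreover have "\<alpha> [y] = [root_perm \<alpha> y]" "\<alpha> [x] = [root_perm \<alpha> x]"
      using Aut_T_snoc[OF assms, of "[]"] n by (auto simp: root_perm_def) (metis list.sel(1))+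
    ultimately have "\<alpha> [y] = \<alpha> [x]" by simp
    then have "y = x" using injD[OF bij_is_inj[OF b]] by blast
    then show ?thesis using v by blast
  qed
  then show "bij (state \<alpha> x)" using i by (auto simp: bij_def)
qed

lemma root_perm_tilde: "root_perm (tilde x0 \<alpha> \<omega>) x = x"
  by (simp add: root_perm_def)

lemma state_tilde:
  assumes "\<omega> \<in> seqs x0"
  shows "state (tilde x0 \<alpha> \<omega>) x0 = tilde x0 \<alpha> (\<omega> \<circ> Suc)"
    and "state (tilde x0 \<alpha> \<omega>) (\<omega> 0) = \<alpha>"
    and "x \<noteq> x0 \<Longrightarrow> x \<noteq> \<omega> 0 \<Longrightarrow> state (tilde x0 \<alpha> \<omega>) x = id"
  using assms by (auto simp: state_def fun_eq_iff seqs_def)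

lemma tilde_comp: "tilde x0 \<alpha> \<omega> (tilde x0 \<beta> \<omega> w) = tilde x0 (\<alpha> \<circ> \<beta>) \<omega> w"
  by (induction w arbitrary: \<omega>) auto

lemma tilde_id: "tilde x0 id \<omega> w = w"
  by (induction w arbitrary: \<omega>) auto

lemma tilde_in_Aut_T:
  assumes "\<alpha> \<in> carrier Aut_T"
  shows "tilde x0 \<alpha> \<omega> \<in> carrier Aut_T"
proof (rule Aut_TI)
  have b: "bij \<alpha>" and n: "\<alpha> [] = []" using assms by (auto simp: Aut_T_def)
  have "\<alpha> \<circ> inv_into UNIV \<alpha> = id" "inv_into UNIV \<alpha> \<circ> \<alpha> = id"
    using b by (auto simp: bij_is_inj surj_iff[symmetric] bij_is_surj)
  then have "tilde x0 (inv_into UNIV \<alpha>) \<omega> \<circ> tilde x0 \<alpha> \<omega> = id"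
    and "tilde x0 \<alpha> \<omega> \<circ> tilde x0 (inv_into UNIV \<alpha>) \<omega> = id"
    by (simp_all add: fun_eq_iff[of "_ \<circ> tilde x0 _ _"] tilde_comp tilde_id)
  then show "bij (tilde x0 \<alpha> \<omega>)" by (rule o_bij)
  show "\<exists>y. tilde x0 \<alpha> \<omega> (w @ [x]) = tilde x0 \<alpha> \<omega> w @ [y]" for w x
    using Aut_T_snoc[OF assms] by (induction w arbitrary: \<omega>) (auto simp: n)
qed simp

end

theory Submission
  imports Defs
begin

text \<open>
  The proof attaches to every group of the family a countable collection of sets of numbers that
  depends on its isomorphism type only, and shows that these collections together contain every set
  of positive integers.  With countably many isomorphism types the union would be countable.

  The sets come from the coincidences of \<open>\<omega>\<close> and \<open>\<omega>'\<close>.  The elements \<open>tilde x0 f \<omega>\<close> and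
  \<open>tilde x0 g \<omega>'\<close> both act next to the spine \<open>x0, x0 x0, x0 x0 x0, \<dots>\<close> of the tree, and they act at
  a common vertex of level \<open>k + 1\<close> exactly if \<open>\<omega> k = \<omega>' k\<close>.  Their commutator therefore
  carries a copy of \<open>[f, g]\<close> at each coincidence and is trivial elsewhere (\<open>comm_tilde_tilde\<close>).
  As \<open>G\<close> is perfect, every \<open>r \<in> G\<close> can take the place of \<open>[f, g]\<close>, in particular one that moves all
  letters (\<open>derangement_G\<close>).  For the resulting element \<open>c\<close> the coincidences can be read off
  from the ways to write \<open>c\<close> as a product \<open>a b\<close> with factors from two commuting subgroups that
  are large together: the levels at which such an \<open>a\<close> starts to act are the \<open>k + 1\<close> with
  \<open>\<omega> k = \<omega>' k\<close> (\<open>split_levels_Gamma\<close>).  Property H yields a letter other than \<open>x0\<close> and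
  \<open>\<omega> k\<close>, so the set of coincidences can be prescribed.

  The definition of the split levels refers to the tree only through the level stabilisers, and so
  the remaining point is that an isomorphism maps the \<open>n\<close>-th level stabiliser of one group onto that
  of the other (\<open>image_stab\<close>).  Two facts give this.  On the one hand, the group contains copies of
  perfect groups acting on single subtrees, and a double commutator argument makes each normal
  subgroup comparable with each level stabiliser (\<open>normal_subset_stab_or_stab_subset\<close>).  On the
  other hand, all groups of the family induce the same finite group of permutations on the words of
  length \<open>n\<close> (\<open>same_level_action\<close>), so that comparable means equal.  The required structure inside
  the groups, collected in the locale \<open>branch_tower\<close>, comes from property H and perfectness:
  a commutator of \<open>tilde x0 f \<omega>\<close> with a suitable conjugate of \<open>tilde x0 g \<omega>\<close> is supported in a
  single subtree (\<open>comm_tilde_conj\<close>).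
\<close>

section \<open>Tree automorphisms, sections and grafts\<close>

abbreviation finv :: "('b \<Rightarrow> 'b) \<Rightarrow> 'b \<Rightarrow> 'b" where
  "finv f \<equiv> inv_into UNIV f"

abbreviation comm :: "('b \<Rightarrow> 'b) \<Rightarrow> ('b \<Rightarrow> 'b) \<Rightarrow> 'b \<Rightarrow> 'b" where
  "comm f g \<equiv> f \<circ> g \<circ> finv f \<circ> finv g"

lemma mult_Aut_T [simp]: "f \<otimes>\<^bsub>Aut_T\<^esub> g = f \<circ> g"
  by (simp add: Aut_T_def)

lemma one_Aut_T [simp]: "\<one>\<^bsub>Aut_T\<^esub> = id"
  by (simp add: Aut_T_def)

lemma bij_Aut_T: "g \<in> carrier Aut_T \<Longrightarrow> bij g"
  by (simp add: Aut_T_def)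

lemma Aut_T_Nil: "g \<in> carrier Aut_T \<Longrightarrow> g [] = []"
  by (simp add: Aut_T_def)

lemma finv_comp:
  assumes "bij g"
  shows "g (finv g w) = w" "finv g (g w) = w" "g \<circ> finv g = id" "finv g \<circ> g = id"
  using assms by (auto simp: bij_is_inj bij_is_surj surj_f_inv_f fun_eq_iff)

lemma inv_Aut_T:
  assumes "g \<in> carrier Aut_T"
  shows "inv\<^bsub>Aut_T\<^esub> g = finv g"
  by (rule group.inv_equality[OF group_Aut_T])
     (use assms in \<open>simp_all add: Aut_T_inv_into finv_comp bij_Aut_T\<close>)

lemma commI:
  assumes "bij f" "bij g" "f \<circ> g = c \<circ> g \<circ> f"
  shows "comm f g = c"
proof
  fix w
  have "(f \<circ> g) (finv f (finv g w)) = (c \<circ> g \<circ> f) (finv f (finv g w))"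
    by (simp only: assms(3))
  then show "comm f g w = c w" using finv_comp[OF assms(1)] finv_comp[OF assms(2)] by simp
qed

lemma Aut_T_length:
  assumes "g \<in> carrier Aut_T"
  shows "length (g w) = length w"
  using Aut_T_append[OF assms, of "[]" w] Aut_T_Nil[OF assms] by auto

lemma Aut_T_inj: "g \<in> carrier Aut_T \<Longrightarrow> g u = g v \<longleftrightarrow> u = v"
  by (simp add: bij_Aut_T bij_is_inj inj_eq)

definition state_at :: "('a list \<Rightarrow> 'a list) \<Rightarrow> 'a list \<Rightarrow> 'a list \<Rightarrow> 'a list" where
  "state_at g v w = drop (length v) (g (v @ w))"

lemma state_at_Nil [simp]: "state_at g [] = g"
  by (simp add: state_at_def fun_eq_iff)

lemma state_at_Cons: "state_at g (x # v) = state_at (state g x) v"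
  by (simp add: state_at_def state_def fun_eq_iff drop_Suc)

lemma Aut_T_append_state_at:
  assumes "g \<in> carrier Aut_T"
  shows "g (u @ w) = g u @ state_at g u w"
  using Aut_T_append[OF assms, of u w] Aut_T_length[OF assms, of u] by (auto simp: state_at_def)

lemma Aut_T_take:
  assumes "g \<in> carrier Aut_T"
  shows "take n (g w) = g (take n w)"
proof -
  have "g w = g (take n w) @ state_at g (take n w) (drop n w)"
    using Aut_T_append_state_at[OF assms, of "take n w" "drop n w"] by simp
  then show ?thesis
    using Aut_T_length[OF assms, of "take n w"] Aut_T_length[OF assms, of w] by (cases "n \<le> length w") simp_all
qed

lemma Aut_T_agree_prefix:
  assumes "g \<in> carrier Aut_T" "h \<in> carrier Aut_T" "g (u @ z) = h (u @ z)"
  shows "g u = h u"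
  using assms Aut_T_take[of g "length u" "u @ z"] Aut_T_take[of h "length u" "u @ z"] by simp

lemma Aut_T_move_append:
  assumes "g \<in> carrier Aut_T" "g u \<noteq> u"
  shows "take (length u) (g (u @ z)) \<noteq> u"
  using assms Aut_T_take[of g "length u" "u @ z"] by simp

lemma Aut_T_comp_Cons:
  assumes "g \<in> carrier Aut_T" "h \<in> carrier Aut_T"
  shows "(g \<circ> h) (x # w) = root_perm g (root_perm h x) # state g (root_perm h x) (state h x w)"
  by (simp add: Aut_T_Cons assms)

lemma root_perm_comp:
  assumes "g \<in> carrier Aut_T" "h \<in> carrier Aut_T"
  shows "root_perm (g \<circ> h) x = root_perm g (root_perm h x)"
  unfolding root_perm_def[of "g \<circ> h"] Aut_T_comp_Cons[OF assms] by simp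

lemma state_comp:
  assumes "g \<in> carrier Aut_T" "h \<in> carrier Aut_T"
  shows "state (g \<circ> h) x = state g (root_perm h x) \<circ> state h x"
  unfolding state_def[of "g \<circ> h"] Aut_T_comp_Cons[OF assms] by (simp add: fun_eq_iff)

lemma root_perm_id [simp]: "root_perm id = id"
  by (simp add: root_perm_def fun_eq_iff)

lemma state_id [simp]: "state id x = id"
  by (simp add: state_def fun_eq_iff)

lemma bij_root_perm:
  assumes "g \<in> carrier Aut_T"
  shows "bij (root_perm g)"
proof (rule o_bij)
  note b = finv_comp[OF bij_Aut_T[OF assms]] and i = Aut_T_inv_into[OF assms]
  show "root_perm (finv g) \<circ> root_perm g = id"
    by (rule ext) (use root_perm_comp[OF i assms] in \<open>simp only: b root_perm_id comp_apply\<close>)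
  show "root_perm g \<circ> root_perm (finv g) = id"
    by (rule ext) (use root_perm_comp[OF assms i] in \<open>simp only: b root_perm_id comp_apply\<close>)
qed

definition graft :: "'a list \<Rightarrow> ('a list \<Rightarrow> 'a list) \<Rightarrow> 'a list \<Rightarrow> 'a list" where
  "graft v g w = (if take (length v) w = v then v @ g (drop (length v) w) else w)"

lemma graft_append [simp]: "graft v g (v @ w) = v @ g w"
  by (simp add: graft_def)

lemma graft_other: "take (length v) w \<noteq> v \<Longrightarrow> graft v g w = w"
  by (simp add: graft_def)

lemma graft_Nil [simp]: "graft [] g = g"
  by (simp add: graft_def fun_eq_iff)

lemma graft_singleton [simp]:
  "graft [x] g [] = []" "graft [x] g (y # w) = (if y = x then y # g w else y # w)"
  by (simp_all add: graft_def)

lemma take_eq_appendE: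
  obtains z where "w = v @ z" | "take (length v) w \<noteq> v"
  by (metis append_take_drop_id)

lemma graft_graft: "graft u (graft v g) = graft (u @ v) g"
proof
  fix w
  show "graft u (graft v g) w = graft (u @ v) g w"
  proof (cases w u rule: take_eq_appendE)
    case (1 z)
    then show ?thesis by (simp add: graft_def[of "u @ v"] graft_def[of v])
  next
    case 2
    have "take (length (u @ v)) w \<noteq> u @ v"
    proof
      assume "take (length (u @ v)) w = u @ v"
      then have "take (length u) (take (length (u @ v)) w) = u" by simp
      with 2 show False by (simp add: min_def)
    qed
    with 2 show ?thesis by (simp add: graft_other)
  qed
qed

lemma graft_comp: "graft v (g \<circ> h) = graft v g \<circ> graft v h"
  by (auto simp: graft_def fun_eq_iff)

lemma graft_id [simp]: "graft v id = id"
  by (auto simp: graft_def fun_eq_iff) (metis append_take_drop_id)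

lemma finv_unique: "f \<circ> g = id \<Longrightarrow> g \<circ> f = id \<Longrightarrow> finv f = g"
  by (intro ext inv_equality) (simp_all add: pointfree_idE)

lemma finv_graft:
  assumes "bij g"
  shows "finv (graft v g) = graft v (finv g)"
  by (rule finv_unique) (simp_all add: graft_comp[symmetric] finv_comp[OF assms])

lemma bij_graft:
  assumes "bij g"
  shows "bij (graft v g)"
  by (rule o_bij[of "graft v (finv g)"]) (simp_all add: graft_comp[symmetric] finv_comp[OF assms])

section \<open>Subgroups of the automorphism group\<close>

lemma subgroup_Aut_T_iff:
  "subgroup K Aut_T \<longleftrightarrow> K \<subseteq> carrier Aut_T \<and> id \<in> K \<and>
     (\<forall>f\<in>K. \<forall>g\<in>K. f \<circ> g \<in> K) \<and> (\<forall>f\<in>K. finv f \<in> K)"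
proof
  assume "subgroup K Aut_T"
  then interpret subgroup K Aut_T .
  show "K \<subseteq> carrier Aut_T \<and> id \<in> K \<and>
     (\<forall>f\<in>K. \<forall>g\<in>K. f \<circ> g \<in> K) \<and> (\<forall>f\<in>K. finv f \<in> K)"
  proof (intro conjI ballI)
    show "K \<subseteq> carrier Aut_T" by (rule subset)
    show "id \<in> K" using one_closed by simp
    show "f \<circ> g \<in> K" if "f \<in> K" "g \<in> K" for f g using m_closed[OF that] by simp
    show "finv f \<in> K" if "f \<in> K" for f using m_inv_closed[OF that] inv_Aut_T[OF mem_carrier[OF that]] by simp
  qed
next
  assume "K \<subseteq> carrier Aut_T \<and> id \<in> K \<and>
     (\<forall>f\<in>K. \<forall>g\<in>K. f \<circ> g \<in> K) \<and> (\<forall>f\<in>K. finv f \<in> K)"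
  note K = this[THEN conjunct1] this[THEN conjunct2]
  show "subgroup K Aut_T"
  proof
    show "K \<subseteq> carrier Aut_T" by (rule K)
    show "f \<otimes>\<^bsub>Aut_T\<^esub> g \<in> K" if "f \<in> K" "g \<in> K" for f g
      unfolding mult_Aut_T using K(2) that by blast
    show "\<one>\<^bsub>Aut_T\<^esub> \<in> K" unfolding one_Aut_T using K(2) by blast
    show "inv\<^bsub>Aut_T\<^esub> f \<in> K" if "f \<in> K" for f
      unfolding inv_Aut_T[OF subsetD[OF K(1) that]] using K(2) that by blast
  qed
qed

lemma subgroup_Aut_TD:
  assumes "subgroup K Aut_T"
  shows "id \<in> K" "f \<in> K \<Longrightarrow> g \<in> K \<Longrightarrow> f \<circ> g \<in> K" "f \<in> K \<Longrightarrow> finv f \<in> K"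
    "f \<in> K \<Longrightarrow> f \<in> carrier Aut_T" "f \<in> K \<Longrightarrow> bij f"
  using assms bij_Aut_T unfolding subgroup_Aut_T_iff by auto

lemma generate_Aut_T_induct:
  assumes "g \<in> generate Aut_T S" "S \<subseteq> carrier Aut_T" "\<And>s. s \<in> S \<Longrightarrow> finv s \<in> S"
    and "P id" "\<And>s. s \<in> S \<Longrightarrow> P s"
    and "\<And>f h. f \<in> carrier Aut_T \<Longrightarrow> h \<in> carrier Aut_T \<Longrightarrow> P f \<Longrightarrow> P h \<Longrightarrow> P (f \<circ> h)"
  shows "P g"
proof -
  have "g \<in> carrier Aut_T \<and> P g"
    using assms(1)
  proof induction
    case (eng f h)
    then show ?case
      using assms(6)[of f h] monoid.m_closed[OF group.is_monoid[OF group_Aut_T], of f h]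
      unfolding mult_Aut_T by blast
  next
    case (inv h)
    then have "h \<in> carrier Aut_T" using assms(2) by blast
    then show ?case
      unfolding inv_Aut_T[OF \<open>h \<in> carrier Aut_T\<close>] using assms(3,5) inv Aut_T_inv_into by blast
  next
    case one
    show ?case
      using assms(4) monoid.one_closed[OF group.is_monoid[OF group_Aut_T]]
      unfolding one_Aut_T by blast
  next
    case (incl h)
    then show ?case using assms(2,5) by blast
  qed
  then show ?thesis ..
qed

text \<open>
  The inverse of a commutator is a commutator, so the products of commutators already exhaust \<open>H\<close>.
\<close>

lemma perfect_induct:
  assumes H: "subgroup H Aut_T" and perfect: "derived Aut_T H = H" and "g \<in> H"
    and one: "P id" and comm: "\<And>f h. f \<in> H \<Longrightarrow> h \<in> H \<Longrightarrow> P (comm f h)"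
    and mult: "\<And>f h. f \<in> H \<Longrightarrow> h \<in> H \<Longrightarrow> P f \<Longrightarrow> P h \<Longrightarrow> P (f \<circ> h)"
  shows "P g"
proof -
  note HD = subgroup_Aut_TD[OF H]
  let ?S = "derived_set Aut_T H"
  have "f \<otimes>\<^bsub>Aut_T\<^esub> h \<otimes>\<^bsub>Aut_T\<^esub> inv\<^bsub>Aut_T\<^esub> f \<otimes>\<^bsub>Aut_T\<^esub> inv\<^bsub>Aut_T\<^esub> h = comm f h"
    if "f \<in> H" "h \<in> H" for f h
    using that HD(4) by (simp add: inv_Aut_T)
  then have set_eq: "?S = (\<Union>f\<in>H. \<Union>h\<in>H. {comm f h})"
    by (intro SUP_cong refl) simp
  have sub: "?S \<subseteq> H" unfolding set_eq using HD(2,3) by blast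
  have inv: "finv s \<in> ?S" if s: "s \<in> ?S" for s
  proof -
    obtain f h where fh: "s = comm f h" "f \<in> H" "h \<in> H" using s unfolding set_eq by blast
    note b = finv_comp[OF HD(5)[OF fh(2)]] finv_comp[OF HD(5)[OF fh(3)]]
    have "finv s = comm h f"
      by (rule finv_unique) (simp_all add: fh(1) fun_eq_iff b)
    then show ?thesis unfolding set_eq using fh by blast
  qed
  have gen: "g \<in> generate Aut_T ?S" using \<open>g \<in> H\<close> perfect unfolding derived_def by simp
  have "g \<in> H \<and> P g"
  proof (rule generate_Aut_T_induct[OF gen _ inv, where P = "\<lambda>g. g \<in> H \<and> P g"])
    show "?S \<subseteq> carrier Aut_T" using sub HD(4) by blast
    show "id \<in> H \<and> P id" using HD(1) one ..
    show "s \<in> H \<and> P s" if s: "s \<in> ?S" for s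
    proof
      show "s \<in> H" using s sub by (rule subsetD[rotated])
      show "P s" using s comm unfolding set_eq by blast
    qed
    show "f \<circ> h \<in> H \<and> P (f \<circ> h)" if "f \<in> H \<and> P f" "h \<in> H \<and> P h" for f h
      using that mult HD(2) by blast
  qed
  then show ?thesis ..
qed

section \<open>Towers of branch groups\<close>

definition stab :: "('a list \<Rightarrow> 'a list) set \<Rightarrow> nat \<Rightarrow> ('a list \<Rightarrow> 'a list) set" where
  "stab K n = {g \<in> K. \<forall>w. length w \<le> n \<longrightarrow> g w = w}"

lemma stabD: "g \<in> stab K n \<Longrightarrow> g \<in> K" "g \<in> stab K n \<Longrightarrow> length w \<le> n \<Longrightarrow> g w = w"
  by (simp_all add: stab_def)

lemma subgroup_stab:
  assumes "subgroup K Aut_T"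
  shows "subgroup (stab K n) Aut_T"
proof -
  note KD = subgroup_Aut_TD[OF assms]
  have "finv g w = w" if "g \<in> stab K n" "length w \<le> n" for g w
    using finv_comp(2)[OF KD(5)[OF stabD(1)[OF that(1)]], of w] stabD(2)[OF that] by simp
  then show ?thesis
    unfolding subgroup_Aut_T_iff using KD by (auto simp: stab_def)
qed

text \<open>
  The sequence of the groups \<open>\<Gamma>\<^sub>G\<close> for the iterated shifts of \<open>\<Omega>\<close> is the example to keep in mind.
  The two closure conditions together say that the stabiliser of the first level in \<open>\<Gamma> n\<close> is the
  direct product of copies of \<open>\<Gamma> (n + 1)\<close>, one for each letter.
\<close>

locale branch_tower =
  fixes \<Gamma> :: "nat \<Rightarrow> ('a::finite list \<Rightarrow> 'a list) set"
  assumes subgroup: "subgroup (\<Gamma> n) Aut_T"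
    and state_closed: "g \<in> \<Gamma> n \<Longrightarrow> state g x \<in> \<Gamma> (Suc n)"
    and graft1_closed: "g \<in> \<Gamma> (Suc n) \<Longrightarrow> graft [x] g \<in> \<Gamma> n"
    and perfect: "derived Aut_T (\<Gamma> n) = \<Gamma> n"
    and transitive: "\<exists>g\<in>\<Gamma> n. root_perm g x = y"
    and two_letters: "\<exists>x y :: 'a. x \<noteq> y"
begin

lemmas D = subgroup_Aut_TD[OF subgroup]

lemma state_at_closed: "g \<in> \<Gamma> m \<Longrightarrow> state_at g v \<in> \<Gamma> (m + length v)"
proof (induction v arbitrary: g m)
  case (Cons x v)
  show ?case using Cons.IH[OF state_closed[OF Cons.prems, of x]] by (simp add: state_at_Cons)
qed simp

lemma graft_closed: "g \<in> \<Gamma> (m + length v) \<Longrightarrow> graft v g \<in> \<Gamma> m"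
proof (induction v arbitrary: m)
  case (Cons x v)
  then have "graft v g \<in> \<Gamma> (Suc m)" by simp
  then have "graft [x] (graft v g) \<in> \<Gamma> m" by (rule graft1_closed)
  then show ?case by (simp add: graft_graft)
qed simp

lemma level_transitive: "length u = length v \<Longrightarrow> \<exists>g\<in>\<Gamma> m. g u = v"
proof (induction u v arbitrary: m rule: list_induct2)
  case Nil
  show ?case using D(1) by (intro bexI[of _ id]) simp_all
next
  case (Cons x u y v)
  obtain q where q: "q \<in> \<Gamma> m" "root_perm q x = y" using transitive by blast
  obtain p where p: "p \<in> \<Gamma> (Suc m)" "p u = v" using Cons.IH by blast
  obtain p' where p': "p' \<in> \<Gamma> (Suc m)" "p' = p \<circ> finv (state q x)"
    using D(2)[OF p(1) D(3)[OF state_closed[OF q(1)]]] by blast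
  have "(graft [y] p' \<circ> q) (x # u) = y # v"
    using Aut_T_Cons[OF D(4)[OF q(1)], of x u] q(2) p(2) p'(2)
      finv_comp(2)[OF D(5)[OF state_closed[OF q(1)]]] by simp
  moreover have "graft [y] p' \<circ> q \<in> \<Gamma> m" using D(2)[OF graft1_closed[OF p'(1)] q(1)] .
  ultimately show ?case by blast
qed

lemma moves_some_word: "\<exists>g\<in>\<Gamma> m. \<exists>w. g w \<noteq> w"
proof -
  obtain x y :: 'a where "x \<noteq> y" using two_letters by blast
  moreover obtain g where "g \<in> \<Gamma> m" "g [x] = [y]" using level_transitive[of "[x]" "[y]"] by auto
  ultimately show ?thesis by (intro bexI[of _ g] exI[of _ "[x]"]) simp_all
qed

text \<open>
  A move of a vertex \<open>u @ w\<close> would carry the support of a non-trivial element grafted there off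
  itself.
\<close>

lemma commuting_with_grafts_fixes:
  assumes b: "b \<in> carrier Aut_T"
    and commutes: "\<And>g. g \<in> \<Gamma> (length u) \<Longrightarrow> b \<circ> graft u g = graft u g \<circ> b"
  shows "b (u @ w) = u @ w"
proof (rule ccontr)
  assume moved: "b (u @ w) \<noteq> u @ w"
  obtain g z where g: "g \<in> \<Gamma> (length u + length w)" "g z \<noteq> z" using moves_some_word by blast
  let ?g = "graft (u @ w) g"
  have "b \<circ> ?g = ?g \<circ> b"
    using commutes[OF graft_closed[OF g(1)]] by (simp add: graft_graft)
  then have "b (?g ((u @ w) @ z)) = ?g (b ((u @ w) @ z))" by (metis comp_apply)
  also have "\<dots> = b ((u @ w) @ z)"
    by (rule graft_other[OF Aut_T_move_append[OF b moved]])
  finally have "?g ((u @ w) @ z) = (u @ w) @ z" by (simp only: Aut_T_inj[OF b])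
  then show False using g(2) unfolding graft_append by simp
qed

text \<open>
  If \<open>a\<close> moves \<open>u\<close>, then \<open>[a, graft u f\<^sup>-\<^sup>1]\<close> agrees with \<open>graft u f\<close> on the subtree at \<open>u\<close>, up to a
  factor supported at \<open>a u\<close>.  Its commutator with \<open>graft u g\<close> is therefore \<open>graft u [f, g]\<close>, and
  perfectness turns commutators into arbitrary elements.
\<close>

lemma double_commutator:
  assumes K: "subgroup K Aut_T"
    and normalised: "\<And>k f. k \<in> K \<Longrightarrow> f \<in> \<Gamma> (length u) \<Longrightarrow> graft u f \<circ> k \<circ> finv (graft u f) \<in> K"
    and a: "a \<in> K" "a u \<noteq> u"
    and g: "g \<in> \<Gamma> (length u)"
  shows "graft u g \<in> K"
proof (rule perfect_induct[OF subgroup perfect g, where P = "\<lambda>g. graft u g \<in> K"])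
  note KD = subgroup_Aut_TD[OF K]
  show "graft u id \<in> K" using KD(1) by simp
  show "graft u (f \<circ> g) \<in> K" if "graft u f \<in> K" "graft u g \<in> K" for f g
    using KD(2)[OF that] by (simp add: graft_comp)
  show "graft u (comm f g) \<in> K" if f: "f \<in> \<Gamma> (length u)" and g: "g \<in> \<Gamma> (length u)" for f g
  proof -
    define p where "p = a \<circ> graft u (finv f) \<circ> finv a"
    define k where "k = p \<circ> graft u f"
    have finv_a: "finv a \<in> carrier Aut_T" "finv a u \<noteq> u"
      using KD(3,4) a finv_comp(1)[OF KD(5)[OF a(1)]] by metis+
    have "k = a \<circ> (graft u (finv f) \<circ> finv a \<circ> finv (graft u (finv f)))"
      by (simp add: k_def p_def finv_graft[OF D(5)[OF D(3)[OF f]]] inv_inv_eq[OF D(5)[OF f]]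
          comp_assoc)
    then have k: "k \<in> K" using KD(2)[OF a(1) normalised[OF KD(3)[OF a(1)] D(3)[OF f]]] by simp
    have p_bij: "bij p" unfolding p_def
      by (intro bij_comp bij_graft bij_imp_bij_inv KD(5)[OF a(1)] D(5)[OF f])
    have p_fix: "p (u @ z) = u @ z" for z
    proof -
      have "graft u (finv f) (finv a (u @ z)) = finv a (u @ z)"
        by (rule graft_other[OF Aut_T_move_append[OF finv_a]])
      then show ?thesis by (simp add: p_def finv_comp(1)[OF KD(5)[OF a(1)]])
    qed
    have p_commutes: "p \<circ> graft u s = graft u s \<circ> p" for s
    proof
      fix w
      show "(p \<circ> graft u s) w = (graft u s \<circ> p) w"
      proof (cases w u rule: take_eq_appendE)
        case (1 z)
        then show ?thesis by (simp add: p_fix)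
      next
        case 2
        have "take (length u) (p w) \<noteq> u"
        proof
          assume "take (length u) (p w) = u"
          then obtain z where "p w = u @ z" by (metis append_take_drop_id)
          then have "p w = p (u @ z)" by (simp add: p_fix)
          then have "w = u @ z" using p_bij by (simp add: bij_is_inj inj_eq)
          with 2 show False by simp
        qed
        with 2 show ?thesis by (simp add: graft_other)
      qed
    qed
    have "comm k (graft u g) = graft u (comm f g)"
    proof (rule commI)
      show "bij k" "bij (graft u g)" using KD(5)[OF k] bij_graft[OF D(5)[OF g]] .
      have "graft u (comm f g) \<circ> graft u g \<circ> k = graft u (comm f g \<circ> g) \<circ> p \<circ> graft u f"
        by (simp add: k_def graft_comp comp_assoc)
      also have "\<dots> = p \<circ> (graft u (comm f g \<circ> g) \<circ> graft u f)"
        unfolding p_commutes[symmetric] by (rule comp_assoc)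
      also have "\<dots> = p \<circ> graft u (comm f g \<circ> g \<circ> f)"
        by (simp only: graft_comp)
      also have "comm f g \<circ> g \<circ> f = f \<circ> g"
        by (simp add: fun_eq_iff finv_comp[OF D(5)[OF f]] finv_comp[OF D(5)[OF g]])
      also have "p \<circ> graft u (f \<circ> g) = k \<circ> graft u g"
        by (simp add: k_def graft_comp comp_assoc)
      finally show "k \<circ> graft u g = graft u (comm f g) \<circ> graft u g \<circ> k" by (rule sym)
    qed
    moreover have "comm k (graft u g) = k \<circ> (graft u g \<circ> finv k \<circ> finv (graft u g))"
      by (simp add: comp_assoc)
    ultimately show ?thesis using KD(2)[OF k normalised[OF KD(3)[OF k] g]] by (simp only:)
  qed
qed

lemma stab_decompose:
  assumes g: "g \<in> stab (\<Gamma> 0) n" and u: "length u = n"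
  obtains s g' where "s \<in> \<Gamma> n" "g' \<in> stab (\<Gamma> 0) n" "g = graft u s \<circ> g'" "\<And>z. g' (u @ z) = u @ z"
    "\<And>v z. length v = n \<Longrightarrow> v \<noteq> u \<Longrightarrow> g' (v @ z) = g (v @ z)"
proof -
  have g0: "g \<in> \<Gamma> 0" and fix_n: "\<And>w. length w \<le> n \<Longrightarrow> g w = w" using g stabD by blast+
  define s where "s = state_at g u"
  have s: "s \<in> \<Gamma> n" using state_at_closed[OF g0, of u] u by (simp add: s_def)
  have gu: "g (u @ z) = u @ s z" for z
    using Aut_T_append_state_at[OF D(4)[OF g0], of u z] fix_n u by (simp add: s_def)
  define g' where "g' = graft u (finv s) \<circ> g"
  note sb = finv_comp[OF D(5)[OF s]]
  have other: "g' (v @ z) = g (v @ z)" if "length v = n" "v \<noteq> u" for v z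
    using that graft_other[of u "g (v @ z)"] Aut_T_take[OF D(4)[OF g0], of n "v @ z"] fix_n[of v] u
    by (simp add: g'_def)
  have fixed: "g' (u @ z) = u @ z" for z by (simp add: g'_def gu sb)
  have "graft u (finv s) \<in> \<Gamma> 0" using graft_closed[of _ 0] D(3)[OF s] u by simp
  moreover have "g' w = w" if w: "length w \<le> n" for w
    using w fix_n[OF w] fixed[of "[]"] u by (cases w u rule: take_eq_appendE)
      (auto simp: g'_def graft_other)
  ultimately have "g' \<in> stab (\<Gamma> 0) n" unfolding stab_def g'_def using D(2)[OF _ g0] by blast
  moreover have "g = graft u s \<circ> g'"
    by (simp add: g'_def comp_assoc[symmetric] graft_comp[symmetric] sb)
  ultimately show thesis using that s fixed other by blast
qed

text \<open>
  An element of the level stabiliser is the product of its sections, grafted at the vertices of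
  level \<open>n\<close>; the induction splits them off one at a time.
\<close>

lemma stab_subset_of_grafts:
  assumes N: "subgroup N Aut_T"
    and grafts: "\<And>u g. length u = n \<Longrightarrow> g \<in> \<Gamma> n \<Longrightarrow> graft u g \<in> N"
  shows "stab (\<Gamma> 0) n \<subseteq> N"
proof -
  note ND = subgroup_Aut_TD[OF N]
  have "g \<in> N" if "finite U" "U \<subseteq> {u. length u = n}" "g \<in> stab (\<Gamma> 0) n"
      "\<And>u z. length u = n \<Longrightarrow> u \<notin> U \<Longrightarrow> g (u @ z) = u @ z" for U g
    using that
  proof (induction U arbitrary: g rule: finite_induct)
    case empty
    have "g w = w" for w
    proof (cases "length w \<le> n")
      case False
      then show ?thesis using empty(3)[of "take n w" "drop n w"] by simp
    qed (use empty(2) stabD in blast)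
    then have "g = id" by (simp add: fun_eq_iff)
    show ?case unfolding \<open>g = id\<close> by (rule ND(1))
  next
    case (insert u U)
    then have u: "length u = n" by simp
    obtain s g' where g': "s \<in> \<Gamma> n" "g' \<in> stab (\<Gamma> 0) n" "g = graft u s \<circ> g'"
      "\<And>z. g' (u @ z) = u @ z" "\<And>v z. length v = n \<Longrightarrow> v \<noteq> u \<Longrightarrow> g' (v @ z) = g (v @ z)"
      using stab_decompose[OF insert.prems(2) u] by blast
    have "g' \<in> N"
    proof (rule insert.IH)
      show "g' (v @ z) = v @ z" if "length v = n" "v \<notin> U" for v z
        using g'(4,5) that insert.prems(3) by (cases "v = u") auto
    qed (use insert.prems g'(2) in auto)
    then show ?case unfolding g'(3) by (rule ND(2)[OF grafts[OF u g'(1)]])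
  qed
  moreover have "finite {u :: 'a list. length u = n}"
    using finite_lists_length_eq[of "UNIV :: 'a set"] by simp
  ultimately show ?thesis by blast
qed

text \<open>
  If an element of \<open>N\<close> moves a vertex of level \<open>n\<close>, then by level transitivity every vertex of
  this level is moved by one of its conjugates, and \<open>double_commutator\<close> applies to each of them.
\<close>

lemma normal_subset_stab_or_stab_subset:
  assumes N: "subgroup N Aut_T" "N \<subseteq> \<Gamma> 0"
    and normal: "\<And>k g. k \<in> N \<Longrightarrow> g \<in> \<Gamma> 0 \<Longrightarrow> g \<circ> k \<circ> finv g \<in> N"
  shows "N \<subseteq> stab (\<Gamma> 0) n \<or> stab (\<Gamma> 0) n \<subseteq> N"
proof (cases "N \<subseteq> stab (\<Gamma> 0) n")
  case False
  note ND = subgroup_Aut_TD[OF N(1)]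
  obtain a u where a: "a \<in> N" and u: "length u \<le> n" "a u \<noteq> u"
    using False N(2) unfolding stab_def by blast
  define u' where "u' = u @ replicate (n - length u) undefined"
  have u': "length u' = n" "a u' \<noteq> u'"
    using u Aut_T_agree_prefix[OF ND(4)[OF a] ND(4)[OF ND(1)]] by (auto simp: u'_def)
  have "graft v g \<in> N" if v: "length v = n" and g: "g \<in> \<Gamma> n" for v g
  proof -
    obtain h where h: "h \<in> \<Gamma> 0" "h u' = v" using level_transitive[of u' v 0] u'(1) v by auto
    note hb = finv_comp[OF D(5)[OF h(1)]]
    let ?a = "h \<circ> a \<circ> finv h"
    have "?a v = h (a u')" using hb(2)[of u'] h(2) by simp
    then have moved: "?a v \<noteq> v" using u'(2) h(2) Aut_T_inj[OF D(4)[OF h(1)]] by metis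
    show ?thesis
    proof (rule double_commutator[OF N(1) _ normal[OF a h(1)] moved])
      show "graft v f \<circ> k \<circ> finv (graft v f) \<in> N" if "k \<in> N" "f \<in> \<Gamma> (length v)" for k f
        using that normal graft_closed[of f 0 v] by simp
    qed (use g v in simp)
  qed
  then show ?thesis using stab_subset_of_grafts[OF N(1)] by blast
qed simp

text \<open>
  If commuting subgroups \<open>A\<close> and \<open>B\<close> together exhaust a level stabiliser, then \<open>A\<close> is normalised by
  that stabiliser.  So \<open>A\<close> contains everything grafted at a deep vertex that it moves, and \<open>B\<close> has
  to commute with all of this.
\<close>

lemma commuting_factors_disjoint:
  assumes A: "subgroup A Aut_T" and B: "subgroup B Aut_T"
    and commute: "\<And>x y. x \<in> A \<Longrightarrow> y \<in> B \<Longrightarrow> x \<circ> y = y \<circ> x"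
    and exhaust: "stab (\<Gamma> 0) N \<subseteq> {x \<circ> y |x y. x \<in> A \<and> y \<in> B}"
    and a: "a \<in> A" "a u \<noteq> u" and u: "N \<le> length u" and b: "b \<in> B"
  shows "b u = u"
proof -
  note AD = subgroup_Aut_TD[OF A] and BD = subgroup_Aut_TD[OF B]
  have graft_A: "graft u g \<in> A" if g: "g \<in> \<Gamma> (length u)" for g
  proof (rule double_commutator[OF A _ a g])
    fix k f assume k: "k \<in> A" and f: "f \<in> \<Gamma> (length u)"
    have "graft u f w = w" if "length w \<le> N" for w
    proof (cases w u rule: take_eq_appendE)
      case (1 z)
      then have "length z = 0" using that u by (simp del: length_0_conv)
      then show ?thesis using 1 Aut_T_Nil[OF D(4)[OF f]] graft_append[of u f "[]"] by simp
    qed (rule graft_other)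
    then have "graft u f \<in> stab (\<Gamma> 0) N"
      using graft_closed[of f 0 u] f by (simp add: stab_def)
    then obtain x y where xy: "graft u f = x \<circ> y" "x \<in> A" "y \<in> B" using exhaust by blast
    have "finv (x \<circ> y) = finv y \<circ> finv x"
      by (rule o_inv_distrib) (use AD(5) BD(5) xy in auto)
    then have "graft u f \<circ> k \<circ> finv (graft u f) = x \<circ> (y \<circ> k) \<circ> finv y \<circ> finv x"
      by (simp add: xy(1) comp_assoc)
    also have "\<dots> = x \<circ> k \<circ> (y \<circ> finv y) \<circ> finv x"
      by (simp only: commute[OF k xy(3), symmetric] comp_assoc)
    finally show "graft u f \<circ> k \<circ> finv (graft u f) \<in> A"
      using finv_comp(3)[OF BD(5)[OF xy(3)]] AD(2,3) k xy(2) by simp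
  qed
  have "b (u @ []) = u @ []"
    by (rule commuting_with_grafts_fixes[OF BD(4)[OF b]]) (use commute[OF graft_A b] in simp)
  then show ?thesis by simp
qed

end

section \<open>Isomorphisms preserve the level stabilisers\<close>

definition block :: "('a \<Rightarrow> 'a list \<Rightarrow> 'a list) \<Rightarrow> 'a list \<Rightarrow> 'a list" where
  "block f w = (case w of [] \<Rightarrow> [] | y # w \<Rightarrow> y # f y w)"

lemma block_simps [simp]: "block f [] = []" "block f (y # w) = y # f y w"
  by (simp_all add: block_def)

lemma (in branch_tower) block_closed:
  assumes "\<And>y. f y \<in> \<Gamma> (Suc m)"
  shows "block f \<in> \<Gamma> m"
proof -
  have "block (\<lambda>y. if y \<in> S then f y else id) \<in> \<Gamma> m" if "finite S" for S
    using that
  proof (induction S rule: finite_induct)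
    case empty
    have "block (\<lambda>y. id) = (id :: 'a list \<Rightarrow> 'a list)" by (simp add: block_def fun_eq_iff split: list.split)
    then show ?case using D(1) by (simp only: empty_iff if_False)
  next
    case (insert x S)
    have "block (\<lambda>y. if y \<in> insert x S then f y else id)
        = graft [x] (f x) \<circ> block (\<lambda>y. if y \<in> S then f y else id)" (is "?l = ?r")
    proof
      show "?l w = ?r w" for w using insert(2) by (cases w) auto
    qed
    then show ?case using D(2)[OF graft1_closed[OF assms] insert.IH] by (simp only:)
  qed
  from this[of UNIV] show ?thesis by simp
qed

text \<open>
  The action of a member of a tower on words of bounded length only depends on the permutations
  that occur at the root: these can be prescribed independently at all vertices.
\<close>

lemma same_level_action:
  assumes "branch_tower \<Gamma>" "branch_tower \<Gamma>'"
    and roots: "\<And>m. root_perm ` \<Gamma> m \<subseteq> root_perm ` \<Gamma>' m" and "g \<in> \<Gamma> m"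
  shows "\<exists>g'\<in>\<Gamma>' m. \<forall>w. length w \<le> n \<longrightarrow> g' w = g w"
  using \<open>g \<in> \<Gamma> m\<close>
proof (induction n arbitrary: g m)
  case 0
  interpret S: branch_tower \<Gamma> by fact
  interpret T: branch_tower \<Gamma>' by fact
  show ?case using T.D(1) Aut_T_Nil[OF S.D(4)[OF 0]] by (intro bexI[of _ id]) simp_all
next
  case (Suc n)
  interpret S: branch_tower \<Gamma> by fact
  interpret T: branch_tower \<Gamma>' by fact
  obtain q where q: "q \<in> \<Gamma>' m" "root_perm q = root_perm g"
    using roots[of m] Suc.prems by (metis imageE imageI subsetD)
  obtain h where h: "\<And>x. h x \<in> \<Gamma>' (Suc m)"
    "\<And>x w. length w \<le> n \<Longrightarrow> h x w = state g x w"
    using Suc.IH[OF S.state_closed[OF Suc.prems]] by metis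
  define f where "f y = (let x = finv (root_perm q) y in h x \<circ> finv (state q x))" for y
  have "f y \<in> \<Gamma>' (Suc m)" for y
    unfolding f_def Let_def by (intro T.D(2,3) h T.state_closed q(1))
  then have "block f \<circ> q \<in> \<Gamma>' m" using T.D(2) T.block_closed q(1) by blast
  moreover have "(block f \<circ> q) w = g w" if "length w \<le> Suc n" for w
  proof (cases w)
    case Nil
    then show ?thesis using Aut_T_Nil[OF T.D(4)[OF q(1)]] Aut_T_Nil[OF S.D(4)[OF Suc.prems]] by simp
  next
    case (Cons x z)
    have "(block f \<circ> q) w = root_perm q x # f (root_perm q x) (state q x z)"
      by (simp add: Cons Aut_T_Cons[OF T.D(4)[OF q(1)]])
    also have "f (root_perm q x) (state q x z) = h x z"
      by (simp add: f_def finv_comp(2)[OF bij_root_perm[OF T.D(4)[OF q(1)]]]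
          finv_comp(2)[OF T.D(5)[OF T.state_closed[OF q(1)]]])
    also have "h x z = state g x z" using h(2) Cons that by simp
    finally show ?thesis by (simp add: Cons q(2) Aut_T_Cons[OF S.D(4)[OF Suc.prems]])
  qed
  ultimately show ?case by blast
qed

definition level_action :: "nat \<Rightarrow> ('a list \<Rightarrow> 'a list) \<Rightarrow> 'a list \<Rightarrow> 'a list" where
  "level_action n g w = (if length w \<le> n then g w else [])"

lemma level_action_eq_iff:
  "level_action n g = level_action n h \<longleftrightarrow> (\<forall>w. length w \<le> n \<longrightarrow> g w = h w)"
  by (auto simp: level_action_def fun_eq_iff)

lemma finite_level_actions:
  fixes K :: "('a::finite list \<Rightarrow> 'a list) set"
  assumes "K \<subseteq> carrier Aut_T"
  shows "finite (level_action n ` K)"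
proof (rule finite_subset)
  let ?W = "{w :: 'a list. length w \<le> n}"
  show "level_action n ` K \<subseteq> {f. \<forall>w. (w \<in> ?W \<longrightarrow> f w \<in> ?W) \<and> (w \<notin> ?W \<longrightarrow> f w = [])}"
    using Aut_T_length[OF subsetD[OF assms]] by (auto simp: level_action_def)
  have "finite ?W" using finite_lists_length_le[of "UNIV :: 'a set" n] by simp
  then show "finite {f. \<forall>w. (w \<in> ?W \<longrightarrow> f w \<in> ?W) \<and> (w \<notin> ?W \<longrightarrow> f w = ([] :: 'a list))}"
    by (intro finite_set_of_finite_funs)
qed

locale tower_iso = S: branch_tower \<Gamma> + T: branch_tower \<Gamma>'
  for \<Gamma> \<Gamma>' :: "nat \<Rightarrow> ('a::finite list \<Rightarrow> 'a list) set" +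
  fixes \<phi> :: "('a list \<Rightarrow> 'a list) \<Rightarrow> 'a list \<Rightarrow> 'a list"
  assumes bij_\<phi>: "bij_betw \<phi> (\<Gamma> 0) (\<Gamma>' 0)"
    and hom: "g \<in> \<Gamma> 0 \<Longrightarrow> h \<in> \<Gamma> 0 \<Longrightarrow> \<phi> (g \<circ> h) = \<phi> g \<circ> \<phi> h"
    and same_roots: "root_perm ` \<Gamma> m = root_perm ` \<Gamma>' m"
begin

lemma \<phi>_closed: "g \<in> \<Gamma> 0 \<Longrightarrow> \<phi> g \<in> \<Gamma>' 0"
  using bij_\<phi> by (rule bij_betw_apply)

lemma \<phi>_id: "\<phi> id = id"
proof -
  have "\<phi> id \<circ> \<phi> id = \<phi> id" using hom[OF S.D(1) S.D(1)] by (simp only: id_comp)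
  then have "\<phi> id w = w" for w
    using T.D(5)[OF \<phi>_closed[OF S.D(1)]] by (metis bij_pointE comp_apply)
  then show ?thesis by (simp add: fun_eq_iff)
qed

lemma \<phi>_finv:
  assumes g: "g \<in> \<Gamma> 0"
  shows "\<phi> (finv g) = finv (\<phi> g)"
proof (rule finv_unique[symmetric])
  show "\<phi> g \<circ> \<phi> (finv g) = id" "\<phi> (finv g) \<circ> \<phi> g = id"
    using hom[OF g S.D(3)[OF g]] hom[OF S.D(3)[OF g] g]
    by (simp_all only: finv_comp[OF S.D(5)[OF g]] \<phi>_id)
qed

lemma inverse_iso: "tower_iso \<Gamma>' \<Gamma> (inv_into (\<Gamma> 0) \<phi>)"
proof unfold_locales
  show "bij_betw (inv_into (\<Gamma> 0) \<phi>) (\<Gamma>' 0) (\<Gamma> 0)" by (rule bij_betw_inv_into[OF bij_\<phi>])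
  show "root_perm ` \<Gamma>' m = root_perm ` \<Gamma> m" for m using same_roots by simp
  note i = bij_betw_imp_inj_on[OF bij_\<phi>]
  show "inv_into (\<Gamma> 0) \<phi> (g \<circ> h) = inv_into (\<Gamma> 0) \<phi> g \<circ> inv_into (\<Gamma> 0) \<phi> h"
    if gh: "g \<in> \<Gamma>' 0" "h \<in> \<Gamma>' 0" for g h
  proof -
    obtain g' h' where "g' \<in> \<Gamma> 0" "h' \<in> \<Gamma> 0" "g = \<phi> g'" "h = \<phi> h'"
      using gh bij_betw_imp_surj_on[OF bij_\<phi>] by blast
    then show ?thesis by (simp only: hom[symmetric] inv_into_f_f[OF i] S.D(2))
  qed
qed

lemma image_subgroup:
  assumes "subgroup A Aut_T" "A \<subseteq> \<Gamma> 0"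
  shows "subgroup (\<phi> ` A) Aut_T"
  unfolding subgroup_Aut_T_iff
proof (intro conjI ballI)
  note AD = subgroup_Aut_TD[OF assms(1)]
  show "\<phi> ` A \<subseteq> carrier Aut_T" using assms(2) \<phi>_closed T.D(4) by blast
  show "id \<in> \<phi> ` A" using AD(1) \<phi>_id by (metis imageI)
  show "f \<circ> g \<in> \<phi> ` A" if fg: "f \<in> \<phi> ` A" "g \<in> \<phi> ` A" for f g
  proof -
    obtain f' g' where *: "f' \<in> A" "g' \<in> A" "f = \<phi> f'" "g = \<phi> g'" using fg by blast
    have "f \<circ> g = \<phi> (f' \<circ> g')"
      by (simp only: *(3,4) hom[OF subsetD[OF assms(2) *(1)] subsetD[OF assms(2) *(2)]])
    then show ?thesis using AD(2)[OF *(1,2)] by (simp only: imageI)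
  qed
  show "finv f \<in> \<phi> ` A" if f: "f \<in> \<phi> ` A" for f
  proof -
    obtain f' where *: "f' \<in> A" "f = \<phi> f'" using f by blast
    have "finv f = \<phi> (finv f')" by (simp only: *(2) \<phi>_finv[OF subsetD[OF assms(2) *(1)]])
    then show ?thesis using AD(3)[OF *(1)] by (simp only: imageI)
  qed
qed

text \<open>
  The actions of both groups on words of length at most \<open>n\<close> form the same finite set, so the map
  between them that \<open>\<phi>\<close> induces is injective as soon as it is well defined.
\<close>

lemma stab_if_image_in_stab:
  assumes sub: "\<phi> ` stab (\<Gamma> 0) n \<subseteq> stab (\<Gamma>' 0) n"
    and g: "g \<in> \<Gamma> 0" "\<phi> g \<in> stab (\<Gamma>' 0) n"
  shows "g \<in> stab (\<Gamma> 0) n"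
proof -
  let ?\<rho> = "level_action n :: ('a list \<Rightarrow> 'a list) \<Rightarrow> 'a list \<Rightarrow> 'a list"
  define A where "A = ?\<rho> ` \<Gamma> 0"
  define e where "e a = ?\<rho> (\<phi> (inv_into (\<Gamma> 0) ?\<rho> a))" for a
  have well_defined: "?\<rho> (\<phi> f) = ?\<rho> (\<phi> h)"
    if fh: "f \<in> \<Gamma> 0" "h \<in> \<Gamma> 0" "?\<rho> f = ?\<rho> h" for f h
  proof -
    have "(finv h \<circ> f) w = w" if "length w \<le> n" for w
      using fh(3) that finv_comp(2)[OF S.D(5)[OF fh(2)]] by (simp add: level_action_eq_iff)
    then have "finv h \<circ> f \<in> stab (\<Gamma> 0) n"
      using S.D(2)[OF S.D(3)[OF fh(2)] fh(1)] by (simp add: stab_def)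
    then have "\<phi> (finv h \<circ> f) \<in> stab (\<Gamma>' 0) n" using sub by blast
    then have "finv (\<phi> h) \<circ> \<phi> f \<in> stab (\<Gamma>' 0) n"
      using hom[OF S.D(3)[OF fh(2)] fh(1)] \<phi>_finv[OF fh(2)] by simp
    then have "finv (\<phi> h) (\<phi> f w) = w" if "length w \<le> n" for w
      using stabD(2)[OF _ that] by fastforce
    then show ?thesis
      using finv_comp(1)[OF T.D(5)[OF \<phi>_closed[OF fh(2)]]] unfolding level_action_eq_iff by metis
  qed
  have e: "e (?\<rho> f) = ?\<rho> (\<phi> f)" if f: "f \<in> \<Gamma> 0" for f
    unfolding e_def
    by (rule well_defined[OF inv_into_into[OF imageI[OF f]] f f_inv_into_f[OF imageI[OF f]]])
  have "?\<rho> ` \<Gamma> 0 \<subseteq> ?\<rho> ` \<Gamma>' 0"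
  proof
    fix a assume "a \<in> ?\<rho> ` \<Gamma> 0"
    then obtain f where f: "f \<in> \<Gamma> 0" "a = ?\<rho> f" by blast
    obtain f' where f': "f' \<in> \<Gamma>' 0" "\<forall>w. length w \<le> n \<longrightarrow> f' w = f w"
      using same_level_action[OF S.branch_tower_axioms T.branch_tower_axioms _ f(1)] same_roots
      by blast
    then have "a = ?\<rho> f'" by (simp add: f(2) level_action_eq_iff)
    then show "a \<in> ?\<rho> ` \<Gamma>' 0" using f'(1) by (rule image_eqI)
  qed
  also have "\<Gamma>' 0 = \<phi> ` \<Gamma> 0" using bij_betw_imp_surj_on[OF bij_\<phi>] by simp
  finally have "A \<subseteq> (\<lambda>f. ?\<rho> (\<phi> f)) ` \<Gamma> 0" by (simp only: A_def image_image)
  also have "\<dots> = e ` A" unfolding A_def image_image by (rule image_cong) (simp_all add: e)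
  finally have "A \<subseteq> e ` A" .
  moreover have "finite A" unfolding A_def by (rule finite_level_actions) (use S.D(4) in blast)
  ultimately have "inj_on e A" by (rule finite_surj_inj[rotated])
  moreover have "e (?\<rho> g) = e (?\<rho> id)"
    using g(2) e[OF g(1)] e[OF S.D(1)] \<phi>_id by (simp add: level_action_eq_iff stab_def)
  ultimately have "?\<rho> g = ?\<rho> id" using g(1) S.D(1) unfolding A_def by (meson imageI inj_onD)
  then show ?thesis using g(1) by (simp add: level_action_eq_iff stab_def)
qed

lemma image_stab: "\<phi> ` stab (\<Gamma> 0) n = stab (\<Gamma>' 0) n"
proof -
  interpret inverse: tower_iso \<Gamma>' \<Gamma> "inv_into (\<Gamma> 0) \<phi>" by (rule inverse_iso)
  note i = inv_into_f_f[OF bij_betw_imp_inj_on[OF bij_\<phi>]]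
  have surj: "\<Gamma>' 0 = \<phi> ` \<Gamma> 0" using bij_betw_imp_surj_on[OF bij_\<phi>] by simp
  have stab0: "stab (\<Gamma> 0) n \<subseteq> \<Gamma> 0" by (auto simp: stab_def)
  have "\<phi> ` stab (\<Gamma> 0) n \<subseteq> stab (\<Gamma>' 0) n \<or> stab (\<Gamma>' 0) n \<subseteq> \<phi> ` stab (\<Gamma> 0) n"
  proof (rule T.normal_subset_stab_or_stab_subset)
    show "subgroup (\<phi> ` stab (\<Gamma> 0) n) Aut_T"
      by (rule image_subgroup[OF subgroup_stab[OF S.subgroup] stab0])
    show "\<phi> ` stab (\<Gamma> 0) n \<subseteq> \<Gamma>' 0" using stab0 \<phi>_closed by blast
    show "g \<circ> k \<circ> finv g \<in> \<phi> ` stab (\<Gamma> 0) n" if kg: "k \<in> \<phi> ` stab (\<Gamma> 0) n" "g \<in> \<Gamma>' 0" for k g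
    proof -
      obtain k' g' where k: "k' \<in> stab (\<Gamma> 0) n" "k = \<phi> k'" and g: "g' \<in> \<Gamma> 0" "g = \<phi> g'"
        using kg surj by blast
      note k0 = stabD(1)[OF k(1)]
      let ?c = "g' \<circ> k' \<circ> finv g'"
      have "?c w = w" if "length w \<le> n" for w
      proof -
        have "length (finv g' w) \<le> n"
          using Aut_T_length[OF S.D(4)[OF S.D(3)[OF g(1)]], of w] that by simp
        then show ?thesis using stabD(2)[OF k(1)] finv_comp(1)[OF S.D(5)[OF g(1)]] by simp
      qed
      then have "?c \<in> stab (\<Gamma> 0) n"
        using S.D(2)[OF S.D(2)[OF g(1) k0] S.D(3)[OF g(1)]] by (simp add: stab_def)
      moreover have "\<phi> ?c = g \<circ> k \<circ> finv g"
        by (simp only: hom[OF S.D(2)[OF g(1) k0] S.D(3)[OF g(1)]] hom[OF g(1) k0] \<phi>_finv[OF g(1)]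
            k(2) g(2))
      ultimately show ?thesis by (metis imageI)
    qed
  qed
  moreover have "\<phi> ` stab (\<Gamma> 0) n \<subseteq> stab (\<Gamma>' 0) n" if sub: "stab (\<Gamma>' 0) n \<subseteq> \<phi> ` stab (\<Gamma> 0) n"
  proof (rule image_subsetI)
    fix g assume g: "g \<in> stab (\<Gamma> 0) n"
    then have g0: "g \<in> \<Gamma> 0" using stab0 by blast
    have "inv_into (\<Gamma> 0) \<phi> ` stab (\<Gamma>' 0) n \<subseteq> stab (\<Gamma> 0) n"
      using sub stab0 i by fastforce
    then show "\<phi> g \<in> stab (\<Gamma>' 0) n"
      by (rule inverse.stab_if_image_in_stab[OF _ \<phi>_closed[OF g0]]) (simp only: i[OF g0] g)
  qed
  ultimately have sub: "\<phi> ` stab (\<Gamma> 0) n \<subseteq> stab (\<Gamma>' 0) n" by blast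
  have "stab (\<Gamma>' 0) n \<subseteq> \<phi> ` stab (\<Gamma> 0) n"
  proof
    fix h assume h: "h \<in> stab (\<Gamma>' 0) n"
    then obtain g where g: "g \<in> \<Gamma> 0" "h = \<phi> g" using surj stabD(1) by blast
    then show "h \<in> \<phi> ` stab (\<Gamma> 0) n" using stab_if_image_in_stab[OF sub] h by blast
  qed
  with sub show ?thesis by blast
qed

end

section \<open>Split levels\<close>

text \<open>
  The definition uses the tree through the level stabilisers only, which isomorphisms preserve.
  That \<open>A\<close> and \<open>B\<close> exhaust one of them forces their supports apart; otherwise a decomposition of
  \<open>c\<close> into two of its own powers, say, would count as well.
\<close>

definition split_levels :: "('a list \<Rightarrow> 'a list) set \<Rightarrow> ('a list \<Rightarrow> 'a list) \<Rightarrow> nat set" where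
  "split_levels K c = {n. \<exists>A B N a b. subgroup A Aut_T \<and> subgroup B Aut_T \<and> A \<subseteq> K \<and> B \<subseteq> K \<and>
     (\<forall>x\<in>A. \<forall>y\<in>B. x \<circ> y = y \<circ> x) \<and> stab K N \<subseteq> {x \<circ> y |x y. x \<in> A \<and> y \<in> B} \<and>
     a \<in> A \<and> b \<in> B \<and> c = a \<circ> b \<and> a \<in> stab K n \<and> a \<notin> stab K (Suc n)}"

lemma split_levelsI:
  assumes "subgroup A Aut_T" "subgroup B Aut_T" "A \<subseteq> K" "B \<subseteq> K"
    "\<And>x y. x \<in> A \<Longrightarrow> y \<in> B \<Longrightarrow> x \<circ> y = y \<circ> x" "stab K N \<subseteq> {x \<circ> y |x y. x \<in> A \<and> y \<in> B}"
    "a \<in> A" "b \<in> B" "c = a \<circ> b" "a \<in> stab K n" "a \<notin> stab K (Suc n)"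
  shows "n \<in> split_levels K c"
  unfolding split_levels_def using assms by blast

lemma (in tower_iso) split_levels_image_supset:
  assumes c: "c \<in> \<Gamma> 0"
  shows "split_levels (\<Gamma> 0) c \<subseteq> split_levels (\<Gamma>' 0) (\<phi> c)"
proof
  fix n assume "n \<in> split_levels (\<Gamma> 0) c"
  then obtain A B N a b where A: "subgroup A Aut_T" "A \<subseteq> \<Gamma> 0" and B: "subgroup B Aut_T" "B \<subseteq> \<Gamma> 0"
    and commute: "\<forall>x\<in>A. \<forall>y\<in>B. x \<circ> y = y \<circ> x"
    and exhaust: "stab (\<Gamma> 0) N \<subseteq> {x \<circ> y |x y. x \<in> A \<and> y \<in> B}"
    and ab: "a \<in> A" "b \<in> B" "c = a \<circ> b" "a \<in> stab (\<Gamma> 0) n" "a \<notin> stab (\<Gamma> 0) (Suc n)"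
    unfolding split_levels_def by blast
  have hom_AB: "\<phi> (x \<circ> y) = \<phi> x \<circ> \<phi> y" "\<phi> (y \<circ> x) = \<phi> y \<circ> \<phi> x" if "x \<in> A" "y \<in> B" for x y
    using hom[of x y] hom[of y x] that A(2) B(2) by (simp_all only: subsetD)
  show "n \<in> split_levels (\<Gamma>' 0) (\<phi> c)"
  proof (rule split_levelsI)
    show "subgroup (\<phi> ` A) Aut_T" "subgroup (\<phi> ` B) Aut_T"
      using image_subgroup A B by blast+
    show "\<phi> ` A \<subseteq> \<Gamma>' 0" "\<phi> ` B \<subseteq> \<Gamma>' 0" using A B \<phi>_closed by blast+
    show "x \<circ> y = y \<circ> x" if xy: "x \<in> \<phi> ` A" "y \<in> \<phi> ` B" for x y
    proof -
      obtain x' y' where *: "x' \<in> A" "y' \<in> B" "x = \<phi> x'" "y = \<phi> y'" using xy by blast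
      then have "x' \<circ> y' = y' \<circ> x'" using commute by blast
      then show ?thesis by (simp only: *(3,4) hom_AB[OF *(1,2), symmetric])
    qed
    show "stab (\<Gamma>' 0) N \<subseteq> {x \<circ> y |x y. x \<in> \<phi> ` A \<and> y \<in> \<phi> ` B}"
    proof
      fix g assume "g \<in> stab (\<Gamma>' 0) N"
      then obtain g' where "g' \<in> stab (\<Gamma> 0) N" "g = \<phi> g'" using image_stab[of N] by blast
      then obtain x y where xy: "g = \<phi> (x \<circ> y)" "x \<in> A" "y \<in> B" using exhaust by blast
      then have "g = \<phi> x \<circ> \<phi> y" by (simp only: hom_AB)
      then show "g \<in> {x \<circ> y |x y. x \<in> \<phi> ` A \<and> y \<in> \<phi> ` B}" using xy(2,3) by blast
    qed
    show "\<phi> a \<in> \<phi> ` A" "\<phi> b \<in> \<phi> ` B" using ab by blast+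
    show "\<phi> c = \<phi> a \<circ> \<phi> b" by (simp only: ab(3) hom_AB[OF ab(1,2)])
    show "\<phi> a \<in> stab (\<Gamma>' 0) n" using image_stab ab(4) by blast
    have sub: "\<phi> ` stab (\<Gamma> 0) (Suc n) \<subseteq> stab (\<Gamma>' 0) (Suc n)" by (simp add: image_stab)
    show "\<phi> a \<notin> stab (\<Gamma>' 0) (Suc n)" using stab_if_image_in_stab[OF sub] ab(1,5) A(2) by blast
  qed
qed

lemma (in tower_iso) split_levels_image:
  assumes c: "c \<in> \<Gamma> 0"
  shows "split_levels (\<Gamma>' 0) (\<phi> c) = split_levels (\<Gamma> 0) c"
proof
  interpret inverse: tower_iso \<Gamma>' \<Gamma> "inv_into (\<Gamma> 0) \<phi>" by (rule inverse_iso)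
  show "split_levels (\<Gamma>' 0) (\<phi> c) \<subseteq> split_levels (\<Gamma> 0) c"
    using inverse.split_levels_image_supset[OF \<phi>_closed[OF c]]
    by (simp only: inv_into_f_f[OF bij_betw_imp_inj_on[OF bij_\<phi>] c])
qed (rule split_levels_image_supset[OF c])

text \<open>
  A factor \<open>a\<close> agrees with \<open>c\<close> on every vertex \<open>u\<close> that it moves, since the other factor is trivial
  deep below \<open>u\<close>.  If \<open>u\<close> has the least possible level, then \<open>c\<close> fixes the parent of \<open>u\<close>, just as
  \<open>a\<close> does.  But \<open>c\<close> moves every vertex strictly below \<open>v k\<close>, because \<open>r\<close> fixes no letter.  So the
  parent of \<open>u\<close> is one of the \<open>v k\<close>.  Conversely, the copy of \<open>r\<close> at a single \<open>v k\<close> is a factor: the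
  two commuting subgroups are the elements acting below \<open>v k\<close> and those acting elsewhere.
\<close>

lemma (in branch_tower) split_levels_eq:
  assumes c: "c \<in> \<Gamma> 0"
    and r: "\<And>k. r \<in> \<Gamma> k" "\<And>x. root_perm r x \<noteq> x"
    and length_v: "\<And>k. length (v k) = Suc k"
    and on: "\<And>k z. k \<in> E \<Longrightarrow> c (v k @ z) = v k @ r z"
    and off: "\<And>w. (\<And>k z. k \<in> E \<Longrightarrow> w \<noteq> v k @ z) \<Longrightarrow> c w = w"
  shows "split_levels (\<Gamma> 0) c = Suc ` E"
proof (intro equalityI subsetI)
  fix n assume "n \<in> split_levels (\<Gamma> 0) c"
  then obtain A B N a b where A: "subgroup A Aut_T" and B: "subgroup B Aut_T"
    and commute: "\<forall>x\<in>A. \<forall>y\<in>B. x \<circ> y = y \<circ> x"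
    and exhaust: "stab (\<Gamma> 0) N \<subseteq> {x \<circ> y |x y. x \<in> A \<and> y \<in> B}"
    and ab: "a \<in> A" "b \<in> B" "c = a \<circ> b" "a \<in> stab (\<Gamma> 0) n" "a \<notin> stab (\<Gamma> 0) (Suc n)"
    unfolding split_levels_def by blast
  have a: "a \<in> carrier Aut_T" using subgroup_Aut_TD(4)[OF A ab(1)] .
  obtain u where u: "length u = Suc n" "a u \<noteq> u"
    using ab(4,5) unfolding stab_def by (auto simp: le_Suc_eq)
  \<comment> \<open>An extension of \<open>u\<close> so deep that the factor \<open>b\<close> is trivial there.\<close>
  define u' where "u' = u @ replicate N undefined"
  have "a u' \<noteq> u'"
    using u(2) Aut_T_agree_prefix[OF a D(4)[OF D(1)], of u] by (auto simp: u'_def)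
  moreover have "N \<le> length u'" by (simp add: u'_def)
  ultimately have "b u' = u'"
    using commuting_factors_disjoint[OF A B _ exhaust ab(1) _ _ ab(2)] commute by blast
  then have "c u' = a u'" by (simp add: ab(3))
  then have cu: "c u = a u" unfolding u'_def by (rule Aut_T_agree_prefix[OF D(4)[OF c] a])
  obtain k z where k: "k \<in> E" and uz: "u = v k @ z" using off[of u] cu u(2) by metis
  have "r z \<noteq> z"
  proof
    assume "r z = z"
    then have "c u = u" using on[OF k, of z] uz by simp
    then show False using cu u(2) by simp
  qed
  then have "z \<noteq> []" using Aut_T_Nil[OF D(4)[OF r(1)]] by blast
  then obtain y z' where z: "z = z' @ [y]" by (metis rev_exhaust)
  have "z' = []"
  proof (cases z')
    case (Cons x w)
    have "c (v k @ z') = a (v k @ z')"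
      by (rule Aut_T_agree_prefix[OF D(4)[OF c] a, of _ "[y]"]) (use cu uz z in simp)
    also have "a (v k @ z') = v k @ z'"
      using stabD(2)[OF ab(4)] u(1) uz z by simp
    finally have "r z' = z'" using on[OF k] by simp
    then show ?thesis using r(2)[of x] Aut_T_Cons[OF D(4)[OF r(1)], of x w] Cons by simp
  qed simp
  then have "n = Suc k" using u(1) uz z length_v[of k] by simp
  then show "n \<in> Suc ` E" using k by blast
next
  fix n assume "n \<in> Suc ` E"
  then obtain k where k: "k \<in> E" "n = Suc k" by blast
  let ?a = "graft (v k) r"
  define A where "A = graft (v k) ` \<Gamma> (Suc k)"
  define B where "B = {g \<in> \<Gamma> 0. \<forall>z. g (v k @ z) = v k @ z}"
  have graft0: "graft (v k) g \<in> \<Gamma> 0" if "g \<in> \<Gamma> (Suc k)" for g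
    using graft_closed[of g 0 "v k"] that length_v by simp
  show "n \<in> split_levels (\<Gamma> 0) c"
  proof (rule split_levelsI)
    show A0: "A \<subseteq> \<Gamma> 0" using graft0 by (auto simp: A_def)
    show "B \<subseteq> \<Gamma> 0" by (auto simp: B_def)
    show "subgroup A Aut_T"
      unfolding subgroup_Aut_T_iff
    proof (intro conjI ballI)
      show "A \<subseteq> carrier Aut_T" using A0 D(4) by blast
      show "id \<in> A" unfolding A_def using imageI[OF D(1), of "graft (v k)"] by simp
      show "f \<circ> g \<in> A" if "f \<in> A" "g \<in> A" for f g
        using that D(2) unfolding A_def by (auto simp: graft_comp[symmetric])
      show "finv f \<in> A" if "f \<in> A" for f
        using that D(3) unfolding A_def by (auto simp: finv_graft D(5))
    qed
    show "subgroup B Aut_T"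
      unfolding subgroup_Aut_T_iff
    proof (intro conjI ballI)
      show "B \<subseteq> carrier Aut_T" using D(4) by (auto simp: B_def)
      show "id \<in> B" using D(1) by (simp add: B_def)
      show "f \<circ> g \<in> B" if "f \<in> B" "g \<in> B" for f g using that D(2) by (simp add: B_def)
      show "finv f \<in> B" if "f \<in> B" for f
        using that D(3) finv_comp(2)[OF D(5)] unfolding B_def by (smt (verit) mem_Collect_eq)
    qed
    show "x \<circ> y = y \<circ> x" if xy: "x \<in> A" "y \<in> B" for x y
    proof
      fix w
      obtain g where g: "x = graft (v k) g" using xy(1) by (auto simp: A_def)
      have y: "y \<in> carrier Aut_T" "\<And>z. y (v k @ z) = v k @ z" using xy(2) D(4) by (auto simp: B_def)
      show "(x \<circ> y) w = (y \<circ> x) w"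
      proof (cases w "v k" rule: take_eq_appendE)
        case (1 z)
        then show ?thesis by (simp add: g y(2))
      next
        case 2
        have "y (take (length (v k)) w) \<noteq> v k"
        proof
          assume "y (take (length (v k)) w) = v k"
          then have "y (take (length (v k)) w) = y (v k)" using y(2)[of "[]"] by simp
          then show False using 2 Aut_T_inj[OF y(1)] by blast
        qed
        then have "take (length (v k)) (y w) \<noteq> v k" by (simp add: Aut_T_take[OF y(1)])
        then show ?thesis using 2 by (simp add: g graft_other)
      qed
    qed
    show "stab (\<Gamma> 0) n \<subseteq> {x \<circ> y |x y. x \<in> A \<and> y \<in> B}"
    proof
      fix g assume g: "g \<in> stab (\<Gamma> 0) n"
      obtain s g' where "s \<in> \<Gamma> n" "g' \<in> stab (\<Gamma> 0) n" "g = graft (v k) s \<circ> g'"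
        "\<And>z. g' (v k @ z) = v k @ z"
        using stab_decompose[OF g, of "v k"] length_v[of k] k(2) by metis
      then show "g \<in> {x \<circ> y |x y. x \<in> A \<and> y \<in> B}"
        unfolding A_def B_def using k(2) stabD(1) by blast
    qed
    show "?a \<in> A" unfolding A_def using r(1) by blast
    show "graft (v k) (finv r) \<circ> c \<in> B"
      unfolding B_def using D(2)[OF graft0[OF D(3)[OF r(1)]] c] on[OF k(1)]
      by (simp add: finv_comp(2)[OF D(5)[OF r(1)]])
    show "c = ?a \<circ> (graft (v k) (finv r) \<circ> c)"
      unfolding comp_assoc[symmetric] graft_comp[symmetric] finv_comp(3)[OF D(5)[OF r(1)]] by simp
    have "?a w = w" if "length w \<le> Suc k" for w
    proof (cases w "v k" rule: take_eq_appendE)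
      case (1 z)
      then have "length z = 0" using that length_v[of k] by (simp del: length_0_conv)
      then show ?thesis using 1 Aut_T_Nil[OF D(4)[OF r(1)]] graft_append[of "v k" r "[]"] by simp
    qed (rule graft_other)
    then show "?a \<in> stab (\<Gamma> 0) n" using graft0[OF r(1)] k(2) by (simp add: stab_def)
    have "?a (v k @ [undefined]) \<noteq> v k @ [undefined]"
      using r(2)[of undefined] Aut_T_Cons[OF D(4)[OF r(1)], of undefined "[]"] by simp
    moreover have "length (v k @ [undefined]) = Suc n" by (simp add: length_v k(2))
    ultimately show "?a \<notin> stab (\<Gamma> 0) (Suc n)" using stabD(2) by (metis order_refl)
  qed
qed

section \<open>The groups \<open>\<Gamma>\<close> form a tower\<close>

abbreviation shift :: "(nat \<Rightarrow> 'a) \<Rightarrow> nat \<Rightarrow> 'a" where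
  "shift \<omega> \<equiv> \<omega> \<circ> Suc"

lemma shift_in_seqs: "\<omega> \<in> seqs x0 \<Longrightarrow> shift \<omega> \<in> seqs x0"
  by (simp add: seqs_def)

lemma tilde_mult: "tilde x0 (f \<circ> g) \<omega> = tilde x0 f \<omega> \<circ> tilde x0 g \<omega>"
  by (simp add: fun_eq_iff tilde_comp)

lemma tilde_one: "tilde x0 id \<omega> = id"
  by (simp add: fun_eq_iff tilde_id)

lemma finv_tilde:
  assumes "bij g"
  shows "finv (tilde x0 g \<omega>) = tilde x0 (finv g) \<omega>"
  by (rule finv_unique) (simp_all only: tilde_mult[symmetric] finv_comp[OF assms] tilde_one)

lemma tilde_eq_grafts:
  assumes "\<omega> \<in> seqs x0"
  shows "tilde x0 g \<omega> = graft [\<omega> 0] g \<circ> graft [x0] (tilde x0 g (shift \<omega>))"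
proof
  have "\<omega> 0 \<noteq> x0" using assms by (simp add: seqs_def)
  then show "tilde x0 g \<omega> w = (graft [\<omega> 0] g \<circ> graft [x0] (tilde x0 g (shift \<omega>))) w" for w
    by (cases w) auto
qed

lemma conj_graft:
  assumes h: "h \<in> carrier Aut_T"
  shows "h \<circ> graft [x] g \<circ> finv h = graft [root_perm h x] (state h x \<circ> g \<circ> finv (state h x))"
    (is "_ = ?r")
proof -
  note hC = Aut_T_Cons[OF h]
  have b: "finv (state h x) (state h x w) = w" for w
    by (rule finv_comp(2)[OF bij_Aut_T[OF state_in_Aut_T[OF h]]])
  have "h \<circ> graft [x] g = ?r \<circ> h"
  proof
    fix w
    show "(h \<circ> graft [x] g) w = (?r \<circ> h) w"
    proof (cases w)
      case (Cons y z)
      have "root_perm h y = root_perm h x \<longleftrightarrow> y = x"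
        using bij_root_perm[OF h] by (simp add: bij_is_inj inj_eq)
      then show ?thesis by (auto simp: Cons hC b)
    qed (simp add: Aut_T_Nil[OF h])
  qed
  then have "h \<circ> graft [x] g \<circ> finv h = ?r \<circ> (h \<circ> finv h)" by (simp only: comp_assoc)
  then show ?thesis by (simp only: finv_comp(3)[OF bij_Aut_T[OF h]] comp_id)
qed

text \<open>
  Below, \<open>q\<close> is a conjugate of \<open>tilde x0 g \<omega>\<close> whose support meets that of \<open>tilde x0 f \<omega>\<close> in the
  subtree at \<open>\<omega> 0\<close> alone, so that the commutator is concentrated there.
\<close>

lemma comm_tilde_conj:
  assumes \<omega>: "\<omega> \<in> seqs x0" and f: "f \<in> carrier Aut_T" and g: "g \<in> carrier Aut_T"
    and h: "h \<in> carrier Aut_T" "root_perm h (\<omega> 0) = \<omega> 0" "root_perm h x0 \<noteq> x0"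
  defines "q \<equiv> h \<circ> tilde x0 g \<omega> \<circ> finv h"
  shows "comm (tilde x0 f \<omega>) q = graft [\<omega> 0] (comm f (state h (\<omega> 0) \<circ> g \<circ> finv (state h (\<omega> 0))))"
proof -
  define g' where "g' = state h (\<omega> 0) \<circ> g \<circ> finv (state h (\<omega> 0))"
  define s where "s = state h x0 \<circ> tilde x0 g (shift \<omega>) \<circ> finv (state h x0)"
  define y where "y = root_perm h x0"
  note b = finv_comp[OF bij_Aut_T[OF h(1)]]
  have ne: "\<omega> 0 \<noteq> x0" using \<omega> by (simp add: seqs_def)
  have y: "y \<noteq> x0" "y \<noteq> \<omega> 0"
    using h(2,3) ne bij_root_perm[OF h(1)] unfolding y_def by (simp, metis bij_pointE)
  have "q = (h \<circ> graft [\<omega> 0] g \<circ> finv h) \<circ> (h \<circ> graft [x0] (tilde x0 g (shift \<omega>)) \<circ> finv h)"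
    by (simp add: q_def tilde_eq_grafts[OF \<omega>] fun_eq_iff b)
  also have "\<dots> = graft [\<omega> 0] g' \<circ> graft [y] s"
    unfolding conj_graft[OF h(1)] h(2) by (simp add: g'_def s_def y_def)
  finally have q: "q = graft [\<omega> 0] g' \<circ> graft [y] s" .
  have g'_bij: "bij g'" unfolding g'_def
    by (intro bij_comp bij_imp_bij_inv bij_Aut_T[OF g] bij_Aut_T[OF state_in_Aut_T[OF h(1)]])
  note c = finv_comp(2)[OF bij_Aut_T[OF f]] finv_comp(2)[OF g'_bij]
  have "comm (tilde x0 f \<omega>) q = graft [\<omega> 0] (comm f g')"
  proof (rule commI)
    show "bij (tilde x0 f \<omega>)" by (rule bij_Aut_T[OF tilde_in_Aut_T[OF f]])
    show "bij q" unfolding q_def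
      by (intro bij_comp bij_imp_bij_inv bij_Aut_T[OF h(1)] bij_Aut_T[OF tilde_in_Aut_T[OF g]])
    show "tilde x0 f \<omega> \<circ> q = graft [\<omega> 0] (comm f g') \<circ> q \<circ> tilde x0 f \<omega>"
    proof
      show "(tilde x0 f \<omega> \<circ> q) w = (graft [\<omega> 0] (comm f g') \<circ> q \<circ> tilde x0 f \<omega>) w" for w
        unfolding q tilde_eq_grafts[OF \<omega>] using y ne by (cases w) (auto simp: c)
    qed
  qed
  then show ?thesis by (simp only: g'_def)
qed

lemma comm_in_derived:
  assumes "H \<subseteq> carrier Aut_T" "f \<in> H" "h \<in> H"
  shows "comm f h \<in> derived Aut_T H"
proof -
  have "comm f h = f \<otimes>\<^bsub>Aut_T\<^esub> h \<otimes>\<^bsub>Aut_T\<^esub> inv\<^bsub>Aut_T\<^esub> f \<otimes>\<^bsub>Aut_T\<^esub> inv\<^bsub>Aut_T\<^esub> h"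
    using assms by (simp add: inv_Aut_T subset_iff)
  then show ?thesis unfolding derived_def using assms(2,3) by (intro generate.incl) blast
qed

locale perfect_H_group =
  fixes x0 :: "'a::finite" and G :: "('a list \<Rightarrow> 'a list) set"
  assumes subgroup_G: "subgroup G Aut_T" and perfect_G: "derived Aut_T G = G"
    and self_similar_G: "self_similar G" and H_G: "property_H G"
begin

lemmas G = subgroup_Aut_TD[OF subgroup_G]

lemma state_G: "g \<in> G \<Longrightarrow> state g x \<in> G"
  using self_similar_G by (simp add: self_similar_def)

lemma transitive_G: "\<exists>g\<in>G. root_perm g x = y"
  using H_G by (simp add: property_H_def)

definition gens :: "(nat \<Rightarrow> 'a) set \<Rightarrow> ('a list \<Rightarrow> 'a list) set" where
  "gens \<Omega> = G \<union> {tilde x0 g \<omega> |g \<omega>. g \<in> G \<and> \<omega> \<in> \<Omega>}"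

lemma gens_carrier: "gens \<Omega> \<subseteq> carrier Aut_T"
  unfolding gens_def using G(4) tilde_in_Aut_T[OF G(4)] by blast

lemma gens_finv: "s \<in> gens \<Omega> \<Longrightarrow> finv s \<in> gens \<Omega>"
  unfolding gens_def using G(3) finv_tilde[OF G(5)] by blast

lemma carrier_Gamma: "carrier (Gamma x0 G \<Omega>) = generate Aut_T (gens \<Omega>)"
  unfolding Gamma_def carrier_subgroup_generated gens_def[symmetric]
  using gens_carrier by (simp add: Int_absorb1)

lemma subgroup_Gamma: "subgroup (carrier (Gamma x0 G \<Omega>)) Aut_T"
  unfolding carrier_Gamma by (rule group.generate_is_subgroup[OF group_Aut_T gens_carrier])

lemmas Gm = subgroup_Aut_TD[OF subgroup_Gamma]

lemma G_Gamma: "g \<in> G \<Longrightarrow> g \<in> carrier (Gamma x0 G \<Omega>)"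
  unfolding carrier_Gamma by (rule generate.incl) (simp add: gens_def)

lemma tilde_Gamma: "g \<in> G \<Longrightarrow> \<omega> \<in> \<Omega> \<Longrightarrow> tilde x0 g \<omega> \<in> carrier (Gamma x0 G \<Omega>)"
  unfolding carrier_Gamma by (rule generate.incl) (auto simp: gens_def)

lemma Gamma_induct [consumes 1, case_names one G tilde mult]:
  assumes g: "g \<in> carrier (Gamma x0 G \<Omega>)" and one: "P id" and inG: "\<And>g. g \<in> G \<Longrightarrow> P g"
    and tilde: "\<And>g \<omega>. g \<in> G \<Longrightarrow> \<omega> \<in> \<Omega> \<Longrightarrow> P (tilde x0 g \<omega>)"
    and mult: "\<And>f h. f \<in> carrier Aut_T \<Longrightarrow> h \<in> carrier Aut_T \<Longrightarrow> P f \<Longrightarrow> P h \<Longrightarrow> P (f \<circ> h)"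
  shows "P g"
proof (rule generate_Aut_T_induct[OF g[unfolded carrier_Gamma] gens_carrier gens_finv one _ mult])
  show "P s" if "s \<in> gens \<Omega>" for s using that inG tilde unfolding gens_def by blast
qed

lemma state_Gamma:
  assumes "g \<in> carrier (Gamma x0 G \<Omega>)" "\<Omega> \<subseteq> seqs x0"
  shows "state g x \<in> carrier (Gamma x0 G (shift ` \<Omega>))"
  using assms(1)
proof (induction arbitrary: x rule: Gamma_induct)
  case one
  show ?case unfolding state_id by (rule Gm(1))
next
  case (G g)
  show ?case by (rule G_Gamma[OF state_G[OF G]])
next
  case (tilde g \<omega>)
  have "\<omega> \<in> seqs x0" using tilde assms(2) by blast
  then consider "state (tilde x0 g \<omega>) x = tilde x0 g (shift \<omega>)" | "state (tilde x0 g \<omega>) x = g"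
    | "state (tilde x0 g \<omega>) x = id"
    using state_tilde by metis
  then show ?case
    using tilde_Gamma[OF tilde(1) imageI[OF tilde(2), of shift]] G_Gamma[OF tilde(1)] Gm(1)
    by cases (simp_all only:)
next
  case (mult f h)
  show ?case unfolding state_comp[OF mult(1,2)] by (rule Gm(2)[OF mult(3,4)])
qed

lemma root_perm_Gamma: "root_perm ` carrier (Gamma x0 G \<Omega>) = root_perm ` G"
proof
  show "root_perm ` G \<subseteq> root_perm ` carrier (Gamma x0 G \<Omega>)" using G_Gamma by blast
  have "\<exists>q\<in>G. root_perm q = root_perm g" if "g \<in> carrier (Gamma x0 G \<Omega>)" for g
    using that
  proof (induction rule: Gamma_induct)
    case (tilde g \<omega>)
    show ?case by (rule bexI[OF _ G(1)], subst root_perm_id) (simp add: root_perm_tilde fun_eq_iff)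
  next
    case (mult f h)
    then obtain p q where "p \<in> G" "q \<in> G" "root_perm p = root_perm f" "root_perm q = root_perm h"
      by blast
    then show ?case
      using mult(1,2) G(2,4)
      by (intro bexI[of _ "p \<circ> q"] ext) (simp_all only: root_perm_comp)
  qed (use G(1) in blast)+
  then show "root_perm ` carrier (Gamma x0 G \<Omega>) \<subseteq> root_perm ` G" by (metis image_subsetI imageI)
qed

text \<open>
  Property H yields the conjugator for \<open>comm_tilde_conj\<close>, and perfectness passes from commutators to
  all of \<open>G\<close>.  This settles the letter \<open>\<omega> 0\<close>; conjugation by \<open>G\<close> reaches the others.
\<close>

lemma graft_G_Gamma:
  assumes \<omega>: "\<omega> \<in> \<Omega>" "\<omega> \<in> seqs x0" and g: "g \<in> G"
  shows "graft [x] g \<in> carrier (Gamma x0 G \<Omega>)"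
proof -
  have ne: "\<omega> 0 \<noteq> x0" using \<omega>(2) by (simp add: seqs_def)
  obtain h where h: "h \<in> G" "root_perm h (\<omega> 0) = \<omega> 0" "root_perm h x0 \<noteq> x0"
    using H_G ne unfolding property_H_def by blast
  have at_\<omega>: "graft [\<omega> 0] g \<in> carrier (Gamma x0 G \<Omega>)" if "g \<in> G" for g
  proof (rule perfect_induct[OF subgroup_G perfect_G that])
    show "graft [\<omega> 0] id \<in> carrier (Gamma x0 G \<Omega>)" unfolding graft_id by (rule Gm(1))
    show "graft [\<omega> 0] (f \<circ> k) \<in> carrier (Gamma x0 G \<Omega>)"
      if "graft [\<omega> 0] f \<in> carrier (Gamma x0 G \<Omega>)" "graft [\<omega> 0] k \<in> carrier (Gamma x0 G \<Omega>)" for f k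
      unfolding graft_comp by (rule Gm(2)[OF that])
    show "graft [\<omega> 0] (comm f k) \<in> carrier (Gamma x0 G \<Omega>)" if f: "f \<in> G" and k: "k \<in> G" for f k
    proof -
      let ?s = "state h (\<omega> 0)"
      note s = state_G[OF h(1), of "\<omega> 0"]
      \<comment> \<open>Chosen so that the conjugation by \<open>h\<close> turns it into \<open>k\<close> at \<open>\<omega> 0\<close>.\<close>
      define k' where "k' = finv ?s \<circ> k \<circ> ?s"
      have k': "k' \<in> G" unfolding k'_def by (intro G(2,3) s k)
      have "?s \<circ> k' \<circ> finv ?s = k" by (simp add: k'_def fun_eq_iff finv_comp[OF G(5)[OF s]])
      then have "graft [\<omega> 0] (comm f k) = comm (tilde x0 f \<omega>) (h \<circ> tilde x0 k' \<omega> \<circ> finv h)"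
        using comm_tilde_conj[OF \<omega>(2) G(4)[OF f] G(4)[OF k'] G(4)[OF h(1)] h(2,3)] by (simp only:)
      then show ?thesis
        using f k' h(1) \<omega>(1) by (simp only:) (intro Gm(2,3) tilde_Gamma G_Gamma)
    qed
  qed
  obtain h where h: "h \<in> G" "root_perm h (\<omega> 0) = x" using transitive_G by blast
  let ?s = "state h (\<omega> 0)"
  note s = state_G[OF h(1), of "\<omega> 0"]
  have "?s \<circ> (finv ?s \<circ> g \<circ> ?s) \<circ> finv ?s = g" by (simp add: fun_eq_iff finv_comp[OF G(5)[OF s]])
  then have "graft [x] g = h \<circ> graft [\<omega> 0] (finv ?s \<circ> g \<circ> ?s) \<circ> finv h"
    unfolding conj_graft[OF G(4)[OF h(1)]] h(2) by (simp only:)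
  then show ?thesis
    by (simp only:) (intro Gm(2,3) G_Gamma[OF h(1)] at_\<omega> G(2,3) g s)
qed

text \<open>
  Once \<open>g\<close> can be removed from \<open>tilde x0 g \<omega>\<close> at \<open>\<omega> 0\<close>, the part at \<open>x0\<close> is left, which is the
  corresponding generator for the shifted sequence.
\<close>

lemma graft_Gamma:
  assumes "\<Omega> \<noteq> {}" "\<Omega> \<subseteq> seqs x0" and "g \<in> carrier (Gamma x0 G (shift ` \<Omega>))"
  shows "graft [x] g \<in> carrier (Gamma x0 G \<Omega>)"
  using assms(3)
proof (induction rule: Gamma_induct)
  case one
  show ?case unfolding graft_id by (rule Gm(1))
next
  case (G g)
  then show ?case using assms(1,2) graft_G_Gamma by blast
next
  case (tilde g \<omega>')
  then obtain \<omega> where \<omega>: "\<omega> \<in> \<Omega>" "\<omega> \<in> seqs x0" "\<omega>' = shift \<omega>" using assms(2) by blast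
  let ?t = "tilde x0 g (shift \<omega>)"
  have eq: "graft [\<omega> 0] (finv g) \<circ> tilde x0 g \<omega> = graft [x0] ?t"
    unfolding tilde_eq_grafts[OF \<omega>(2)] comp_assoc[symmetric] graft_comp[symmetric]
      finv_comp[OF G(5)[OF tilde(1)]] by simp
  have at_x0: "graft [x0] ?t \<in> carrier (Gamma x0 G \<Omega>)"
    unfolding eq[symmetric]
    by (rule Gm(2)[OF graft_G_Gamma[OF \<omega>(1,2) G(3)[OF tilde(1)]] tilde_Gamma[OF tilde(1) \<omega>(1)]])
  obtain h where h: "h \<in> G" "root_perm h x0 = x" using transitive_G by blast
  let ?s = "state h x0"
  note s = state_G[OF h(1), of x0]
  have "graft [x] ?t = graft [x] (finv ?s \<circ> (?s \<circ> ?t \<circ> finv ?s) \<circ> ?s)"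
    by (rule arg_cong[where f = "graft [x]"]) (simp add: fun_eq_iff finv_comp[OF G(5)[OF s]])
  also have "\<dots> = graft [x] (finv ?s) \<circ> (h \<circ> graft [x0] ?t \<circ> finv h) \<circ> graft [x] ?s"
    unfolding conj_graft[OF G(4)[OF h(1)]] h(2) by (simp only: graft_comp)
  finally show ?case unfolding \<omega>(3)
    by (simp only:) (intro Gm(2,3) graft_G_Gamma[OF \<omega>(1,2)] G_Gamma h(1) at_x0 G(3) s)
next
  case (mult f h)
  then show ?case unfolding graft_comp by (intro Gm(2))
qed

lemma perfect_Gamma: "derived Aut_T (carrier (Gamma x0 G \<Omega>)) = carrier (Gamma x0 G \<Omega>)"
proof
  interpret A: group Aut_T by (rule group_Aut_T)
  let ?\<Gamma> = "carrier (Gamma x0 G \<Omega>)"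
  have carrier: "?\<Gamma> \<subseteq> carrier Aut_T" using Gm(4) by blast
  show "derived Aut_T ?\<Gamma> \<subseteq> ?\<Gamma>" by (rule A.derived_incl[OF order_refl subgroup_Gamma])
  note d = subgroup_Aut_TD[OF A.derived_is_subgroup[OF carrier]]
  show "?\<Gamma> \<subseteq> derived Aut_T ?\<Gamma>"
  proof
    fix g assume "g \<in> ?\<Gamma>"
    then show "g \<in> derived Aut_T ?\<Gamma>"
    proof (induction rule: Gamma_induct)
      case (G g)
      then show ?case using A.mono_derived[of G ?\<Gamma>] G_Gamma perfect_G by blast
    next
      case (tilde g \<omega>)
      show ?case
      proof (rule perfect_induct[OF subgroup_G perfect_G tilde(1)])
        show "tilde x0 id \<omega> \<in> derived Aut_T ?\<Gamma>" unfolding tilde_one by (rule d(1))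
        show "tilde x0 (f \<circ> h) \<omega> \<in> derived Aut_T ?\<Gamma>"
          if "tilde x0 f \<omega> \<in> derived Aut_T ?\<Gamma>" "tilde x0 h \<omega> \<in> derived Aut_T ?\<Gamma>" for f h
          unfolding tilde_mult by (rule d(2)[OF that])
        show "tilde x0 (comm f h) \<omega> \<in> derived Aut_T ?\<Gamma>" if f: "f \<in> G" and h: "h \<in> G" for f h
          unfolding tilde_mult finv_tilde[OF G(5)[OF f], symmetric] finv_tilde[OF G(5)[OF h], symmetric]
          by (rule comm_in_derived[OF carrier tilde_Gamma[OF f tilde(2)] tilde_Gamma[OF h tilde(2)]])
      qed
    qed (use d in blast)+
  qed
qed

definition tower :: "(nat \<Rightarrow> 'a) set \<Rightarrow> nat \<Rightarrow> ('a list \<Rightarrow> 'a list) set" where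
  "tower \<Omega> n = carrier (Gamma x0 G (((`) shift ^^ n) \<Omega>))"

lemma tower_0: "tower \<Omega> 0 = carrier (Gamma x0 G \<Omega>)"
  by (simp add: tower_def)

lemma branch_tower_Gamma:
  assumes \<Omega>: "\<Omega> \<noteq> {}" "\<Omega> \<subseteq> seqs x0"
  shows "branch_tower (tower \<Omega>)"
proof (rule branch_tower.intro)
  fix n
  have \<Omega>n: "((`) shift ^^ n) \<Omega> \<noteq> {}" "((`) shift ^^ n) \<Omega> \<subseteq> seqs x0"
  proof (induction n)
    case (Suc n)
    { case 1 show ?case using Suc(1) by simp }
    { case 2 show ?case unfolding funpow.simps comp_apply[of "(`) shift"]
        by (intro image_subsetI shift_in_seqs subsetD[OF Suc(2)]) }
  qed (use \<Omega> in simp_all)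
  show "subgroup (tower \<Omega> n) Aut_T" unfolding tower_def by (rule subgroup_Gamma)
  show "derived Aut_T (tower \<Omega> n) = tower \<Omega> n" unfolding tower_def by (rule perfect_Gamma)
  show "state g x \<in> tower \<Omega> (Suc n)" if "g \<in> tower \<Omega> n" for g x
    using state_Gamma[OF _ \<Omega>n(2)] that by (simp add: tower_def)
  show "graft [x] g \<in> tower \<Omega> n" if "g \<in> tower \<Omega> (Suc n)" for g x
    using graft_Gamma[OF \<Omega>n] that by (simp add: tower_def)
  show "\<exists>g\<in>tower \<Omega> n. root_perm g x = y" for x y
    using transitive_G G_Gamma unfolding tower_def by blast
  obtain \<omega> where "\<omega> \<in> seqs x0" using \<Omega> by blast
  then have "\<omega> 0 \<noteq> x0" by (simp add: seqs_def)
  then show "\<exists>x y :: 'a. x \<noteq> y" by blast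
qed

lemma countable_Gamma:
  assumes "countable G" "countable \<Omega>"
  shows "countable (carrier (Gamma x0 G \<Omega>))"
proof -
  have append: "foldr (\<circ>) (fs @ hs) id = foldr (\<circ>) fs id \<circ> foldr (\<circ>) hs id"
    for fs hs :: "('a list \<Rightarrow> 'a list) list"
    by (induction fs) (simp_all add: comp_assoc)
  have "gens \<Omega> = G \<union> (\<lambda>(g, \<omega>). tilde x0 g \<omega>) ` (G \<times> \<Omega>)" by (auto simp: gens_def)
  then have "countable (gens \<Omega>)" using assms by simp
  have "g \<in> (\<lambda>fs. foldr (\<circ>) fs id) ` lists (gens \<Omega>)" if "g \<in> carrier (Gamma x0 G \<Omega>)" for g
    using that
  proof (induction rule: Gamma_induct)
    case one
    show ?case by (rule image_eqI[of _ _ "[]"]) simp_all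
  next
    case (G g)
    then show ?case by (intro image_eqI[of _ _ "[g]"]) (simp_all add: gens_def)
  next
    case (tilde g \<omega>)
    then show ?case by (intro image_eqI[of _ _ "[tilde x0 g \<omega>]"]) (auto simp: gens_def)
  next
    case (mult f h)
    then obtain fs hs where "f = foldr (\<circ>) fs id" "h = foldr (\<circ>) hs id"
      "fs \<in> lists (gens \<Omega>)" "hs \<in> lists (gens \<Omega>)" by blast
    then show ?case by (intro image_eqI[of _ _ "fs @ hs"]) (simp_all only: append append_in_lists_conv)
  qed
  then have "carrier (Gamma x0 G \<Omega>) \<subseteq> (\<lambda>fs. foldr (\<circ>) fs id) ` lists (gens \<Omega>)" by blast
  then show ?thesis
    using countable_lists[OF \<open>countable (gens \<Omega>)\<close>] by (meson countable_image countable_subset)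
qed

end

section \<open>Elements with prescribed split levels\<close>

text \<open>
  A double count of the pairs \<open>(q, x)\<close> with \<open>q x = x\<close> shows that a transitive group of permutations
  has one fixed point per element on average.  As the identity has more, some element has fewer.
\<close>

lemma transitive_group_derangement:
  fixes Q :: "('a::finite \<Rightarrow> 'a) set"
  assumes id: "id \<in> Q" and comp: "\<And>p q. p \<in> Q \<Longrightarrow> q \<in> Q \<Longrightarrow> p \<circ> q \<in> Q"
    and finv: "\<And>q. q \<in> Q \<Longrightarrow> finv q \<in> Q" and bij: "\<And>q. q \<in> Q \<Longrightarrow> bij q"
    and transitive: "\<And>x y. \<exists>q\<in>Q. q x = y" and two: "(x1 :: 'a) \<noteq> x2"
  shows "\<exists>q\<in>Q. \<forall>x. q x \<noteq> x"
proof (rule ccontr)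
  assume "\<not> ?thesis"
  then have fixed: "{x. q x = x} \<noteq> {}" if "q \<in> Q" for q using that by blast
  have card_Q: "card Q = card (UNIV :: 'a set) * card {q \<in> Q. q x = x}" for x
  proof -
    have same: "card {q \<in> Q. q x = y} = card {q \<in> Q. q x = x}" for y
    proof -
      obtain p where p: "p \<in> Q" "p x = y" using transitive by blast
      note b = finv_comp[OF bij[OF p(1)]]
      have "bij_betw ((\<circ>) p) {q \<in> Q. q x = x} {q \<in> Q. q x = y}"
      proof (rule bij_betw_byWitness[where f' = "(\<circ>) (finv p)"])
        show "(\<circ>) p ` {q \<in> Q. q x = x} \<subseteq> {q \<in> Q. q x = y}"
          using comp[OF p(1)] p(2) by auto
        show "(\<circ>) (finv p) ` {q \<in> Q. q x = y} \<subseteq> {q \<in> Q. q x = x}"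
          using comp[OF finv[OF p(1)]] b(2)[of x] p(2) by auto
      qed (simp_all add: comp_assoc[symmetric] b)
      then show ?thesis by (simp add: bij_betw_same_card)
    qed
    have "Q = (\<Union>y. {q \<in> Q. q x = y})" by blast
    then have "card Q = (\<Sum>y\<in>UNIV. card {q \<in> Q. q x = y})"
      by (subst (1) \<open>Q = _\<close>, intro card_UN_disjoint) auto
    also have "\<dots> = (\<Sum>y\<in>(UNIV :: 'a set). card {q \<in> Q. q x = x})"
      by (rule sum.cong[OF refl same])
    finally show ?thesis by simp
  qed
  have "card (UNIV :: 'a set) * (\<Sum>q\<in>Q. card {x. q x = x}) = card (UNIV :: 'a set) * (\<Sum>x\<in>UNIV. card {q \<in> Q. q x = x})"
    using sum_multicount_gen[of Q "UNIV :: 'a set" "\<lambda>q x. q x = x" "\<lambda>x. card {q \<in> Q. q x = x}"]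
    by simp
  also have "\<dots> = card (UNIV :: 'a set) * card Q"
    by (simp add: sum_distrib_left card_Q[symmetric])
  finally have total: "(\<Sum>q\<in>Q. card {x. q x = x}) = card Q" by simp
  have "(\<Sum>q\<in>Q. 1) < (\<Sum>q\<in>Q. card {x. q x = x})"
  proof (rule sum_strict_mono_ex1)
    show "\<forall>q\<in>Q. 1 \<le> card {x. q x = x}" using fixed by (simp add: Suc_le_eq card_gt_0_iff)
    have "card {x1, x2} \<le> card {x :: 'a. id x = x}" by (rule card_mono) auto
    then show "\<exists>q\<in>Q. 1 < card {x. q x = x}" using id two by (intro bexI[of _ id]) simp_all
  qed simp
  with total show False by simp
qed

text \<open>
  This is \<open>tilde x0 r \<omega>\<close> restricted to the positions at which \<open>\<omega>\<close> and \<open>\<omega>'\<close> coincide.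
\<close>

fun joint :: "'a \<Rightarrow> ('a list \<Rightarrow> 'a list) \<Rightarrow> (nat \<Rightarrow> 'a) \<Rightarrow> (nat \<Rightarrow> 'a) \<Rightarrow> 'a list \<Rightarrow> 'a list" where
  "joint x0 r \<omega> \<omega>' [] = []"
| "joint x0 r \<omega> \<omega>' (x # w) =
     x # (if x = x0 then joint x0 r (shift \<omega>) (shift \<omega>') w
          else if x = \<omega> 0 \<and> x = \<omega>' 0 then r w else w)"

lemma joint_id: "joint x0 id \<omega> \<omega>' = id"
proof
  show "joint x0 id \<omega> \<omega>' w = id w" for w by (induction w arbitrary: \<omega> \<omega>') auto
qed

lemma joint_comp: "joint x0 (r \<circ> s) \<omega> \<omega>' = joint x0 r \<omega> \<omega>' \<circ> joint x0 s \<omega> \<omega>'"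
proof
  show "joint x0 (r \<circ> s) \<omega> \<omega>' w = (joint x0 r \<omega> \<omega>' \<circ> joint x0 s \<omega> \<omega>') w" for w
    by (induction w arbitrary: \<omega> \<omega>') auto
qed

lemma comm_tilde_tilde:
  assumes "f \<in> carrier Aut_T" "g \<in> carrier Aut_T"
  shows "comm (tilde x0 f \<omega>) (tilde x0 g \<omega>') = joint x0 (comm f g) \<omega> \<omega>'"
proof (rule commI)
  show "bij (tilde x0 f \<omega>)" "bij (tilde x0 g \<omega>')"
    by (rule bij_Aut_T[OF tilde_in_Aut_T], fact)+
  note c = finv_comp(2)[OF bij_Aut_T[OF assms(1)]] finv_comp(2)[OF bij_Aut_T[OF assms(2)]]
  show "tilde x0 f \<omega> \<circ> tilde x0 g \<omega>' = joint x0 (comm f g) \<omega> \<omega>' \<circ> tilde x0 g \<omega>' \<circ> tilde x0 f \<omega>"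
  proof
    show "(tilde x0 f \<omega> \<circ> tilde x0 g \<omega>') w
        = (joint x0 (comm f g) \<omega> \<omega>' \<circ> tilde x0 g \<omega>' \<circ> tilde x0 f \<omega>) w" for w
      by (induction w arbitrary: \<omega> \<omega>') (auto simp: c)
  qed
qed

definition off_spine :: "'a \<Rightarrow> (nat \<Rightarrow> 'a) \<Rightarrow> nat \<Rightarrow> 'a list" where
  "off_spine x0 \<omega> k = replicate k x0 @ [\<omega> k]"

lemma off_spine_simps [simp]:
  "off_spine x0 \<omega> 0 = [\<omega> 0]" "off_spine x0 \<omega> (Suc k) = x0 # off_spine x0 (shift \<omega>) k"
  by (simp_all add: off_spine_def)

lemma joint_on:
  assumes "\<omega> \<in> seqs x0" "\<omega> k = \<omega>' k"
  shows "joint x0 r \<omega> \<omega>' (off_spine x0 \<omega> k @ z) = off_spine x0 \<omega> k @ r z"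
  using assms
proof (induction k arbitrary: \<omega> \<omega>')
  case 0
  then have "\<omega> 0 \<noteq> x0" unfolding seqs_def by blast
  then show ?case using 0(2) by auto
next
  case (Suc k)
  have "joint x0 r (shift \<omega>) (shift \<omega>') (off_spine x0 (shift \<omega>) k @ z) = off_spine x0 (shift \<omega>) k @ r z"
    by (rule Suc.IH[OF shift_in_seqs[OF Suc.prems(1)]]) (use Suc.prems(2) in simp)
  then show ?case
    unfolding off_spine_simps append_Cons joint.simps by (simp only: simp_thms if_True)
qed

lemma joint_moves:
  assumes "joint x0 r \<omega> \<omega>' w \<noteq> w"
  shows "\<exists>k z. \<omega> k = \<omega>' k \<and> w = off_spine x0 \<omega> k @ z"
  using assms
proof (induction w arbitrary: \<omega> \<omega>')
  case (Cons x w)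
  show ?case
  proof (cases "x = x0")
    case True
    with Cons.prems have "joint x0 r (shift \<omega>) (shift \<omega>') w \<noteq> w" unfolding joint.simps by metis
    then obtain k z where "shift \<omega> k = shift \<omega>' k" "w = off_spine x0 (shift \<omega>) k @ z"
      using Cons.IH by blast
    then have "\<omega> (Suc k) = \<omega>' (Suc k)" "x # w = off_spine x0 \<omega> (Suc k) @ z"
      unfolding off_spine_simps True by simp_all
    then show ?thesis by blast
  next
    case False
    with Cons.prems have "x = \<omega> 0" "\<omega> 0 = \<omega>' 0" by (auto split: if_splits)
    then show ?thesis by (intro exI[of _ 0] exI[of _ w]) simp
  qed
qed simp

context perfect_H_group
begin

lemma joint_Gamma:
  assumes \<omega>: "\<omega> \<in> \<Omega>" "\<omega>' \<in> \<Omega>" and r: "r \<in> G"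
  shows "joint x0 r \<omega> \<omega>' \<in> carrier (Gamma x0 G \<Omega>)"
proof (rule perfect_induct[OF subgroup_G perfect_G r])
  show "joint x0 id \<omega> \<omega>' \<in> carrier (Gamma x0 G \<Omega>)" unfolding joint_id by (rule Gm(1))
  show "joint x0 (f \<circ> g) \<omega> \<omega>' \<in> carrier (Gamma x0 G \<Omega>)"
    if "joint x0 f \<omega> \<omega>' \<in> carrier (Gamma x0 G \<Omega>)" "joint x0 g \<omega> \<omega>' \<in> carrier (Gamma x0 G \<Omega>)" for f g
    unfolding joint_comp by (rule Gm(2)[OF that])
  show "joint x0 (comm f g) \<omega> \<omega>' \<in> carrier (Gamma x0 G \<Omega>)" if f: "f \<in> G" and g: "g \<in> G" for f g
    unfolding comm_tilde_tilde[OF G(4)[OF f] G(4)[OF g], symmetric]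
    by (intro Gm(2,3) tilde_Gamma f g \<omega>)
qed

lemma derangement_G:
  assumes "(x1 :: 'a) \<noteq> x2"
  shows "\<exists>r\<in>G. \<forall>x. root_perm r x \<noteq> x"
proof -
  have "\<exists>q\<in>root_perm ` G. \<forall>x. q x \<noteq> x"
  proof (rule transitive_group_derangement[OF _ _ _ _ _ assms])
    show "id \<in> root_perm ` G" by (rule image_eqI[OF _ G(1)]) (simp only: root_perm_id)
    show "p \<circ> q \<in> root_perm ` G" if pq: "p \<in> root_perm ` G" "q \<in> root_perm ` G" for p q
    proof -
      obtain f g where *: "f \<in> G" "g \<in> G" "p = root_perm f" "q = root_perm g" using pq by blast
      then have "p \<circ> q = root_perm (f \<circ> g)"
        by (intro ext) (simp add: root_perm_comp G(4))
      then show ?thesis using G(2)[OF *(1,2)] by (rule image_eqI)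
    qed
    show "finv q \<in> root_perm ` G" if q: "q \<in> root_perm ` G" for q
    proof -
      obtain g where g: "g \<in> G" "q = root_perm g" using q by blast
      have "root_perm g (root_perm (finv g) x) = x" for x
        using root_perm_comp[OF G(4)[OF g(1)] G(4)[OF G(3)[OF g(1)]], of x]
        unfolding finv_comp(3)[OF G(5)[OF g(1)]] by simp
      then have "root_perm (finv g) x = finv q x" for x
        using finv_comp(2)[OF bij_root_perm[OF G(4)[OF g(1)]]] unfolding g(2) by metis
      then have "finv q = root_perm (finv g)" by (simp add: fun_eq_iff)
      then show ?thesis using G(3)[OF g(1)] by (rule image_eqI)
    qed
    show "bij q" if "q \<in> root_perm ` G" for q using that bij_root_perm[OF G(4)] by blast
    show "\<exists>q\<in>root_perm ` G. q x = y" for x y using transitive_G by blast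
  qed
  then show ?thesis by blast
qed

lemma split_levels_Gamma:
  assumes \<omega>: "\<omega> \<in> seqs x0" "\<omega>' \<in> seqs x0"
  shows "\<exists>c\<in>carrier (Gamma x0 G {\<omega>, \<omega>'}).
    split_levels (carrier (Gamma x0 G {\<omega>, \<omega>'})) c = Suc ` {k. \<omega> k = \<omega>' k}"
proof -
  interpret branch_tower "tower {\<omega>, \<omega>'}" by (rule branch_tower_Gamma) (use \<omega> in simp_all)
  have "\<omega> 0 \<noteq> x0" using \<omega>(1) by (simp add: seqs_def)
  then obtain r where r: "r \<in> G" "\<And>x. root_perm r x \<noteq> x" using derangement_G by blast
  have c: "joint x0 r \<omega> \<omega>' \<in> tower {\<omega>, \<omega>'} 0"
    unfolding tower_0 by (rule joint_Gamma[OF _ _ r(1)]) simp_all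
  have "split_levels (tower {\<omega>, \<omega>'} 0) (joint x0 r \<omega> \<omega>') = Suc ` {k. \<omega> k = \<omega>' k}"
  proof (rule split_levels_eq[OF c, where v = "off_spine x0 \<omega>"])
    show "r \<in> tower {\<omega>, \<omega>'} k" for k unfolding tower_def by (rule G_Gamma[OF r(1)])
    show "joint x0 r \<omega> \<omega>' w = w" if "\<And>k z. k \<in> {k. \<omega> k = \<omega>' k} \<Longrightarrow> w \<noteq> off_spine x0 \<omega> k @ z" for w
      using that joint_moves[of x0 r \<omega> \<omega>' w] by blast
    show "joint x0 r \<omega> \<omega>' (off_spine x0 \<omega> k @ z) = off_spine x0 \<omega> k @ r z"
      if "k \<in> {k. \<omega> k = \<omega>' k}" for k z
      using joint_on[OF \<omega>(1), of k \<omega>' r z] that by simp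
  qed (use r(2) in \<open>auto simp: off_spine_def\<close>)
  with c show ?thesis unfolding tower_0 by blast
qed

lemma third_letter:
  assumes "x \<noteq> x0"
  shows "\<exists>y. y \<noteq> x0 \<and> y \<noteq> x"
proof -
  obtain g where g: "g \<in> G" "root_perm g x0 = x0" "root_perm g x \<noteq> x"
    using H_G assms unfolding property_H_def by metis
  have "root_perm g x \<noteq> x0"
    using bij_root_perm[OF G(4)[OF g(1)]] g(2) assms by (metis bij_pointE)
  with g(3) show ?thesis by blast
qed

lemma prescribed_coincidences:
  assumes \<omega>: "\<omega> \<in> seqs x0"
  shows "\<exists>\<omega>'\<in>seqs x0. {k. \<omega> k = \<omega>' k} = E"
proof -
  have "\<exists>y. y \<noteq> x0 \<and> \<omega> k \<noteq> y" for k
    using third_letter[of "\<omega> k"] \<omega> unfolding seqs_def by blast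
  then obtain alt where alt: "\<And>k. alt k \<noteq> x0 \<and> \<omega> k \<noteq> alt k" by metis
  let ?\<omega>' = "\<lambda>k. if k \<in> E then \<omega> k else alt k"
  have "?\<omega>' \<in> seqs x0" using alt \<omega> by (simp add: seqs_def)
  moreover have "{k. \<omega> k = ?\<omega>' k} = E" using alt by simp
  ultimately show ?thesis by (intro bexI[of _ ?\<omega>'])
qed

lemma split_levels_iso:
  assumes \<Omega>: "\<Omega> \<noteq> {}" "\<Omega> \<subseteq> seqs x0" "\<Omega>' \<noteq> {}" "\<Omega>' \<subseteq> seqs x0"
    and iso: "Gamma x0 G \<Omega> \<cong> Gamma x0 G \<Omega>'"
  shows "split_levels (carrier (Gamma x0 G \<Omega>)) ` carrier (Gamma x0 G \<Omega>)
    = split_levels (carrier (Gamma x0 G \<Omega>')) ` carrier (Gamma x0 G \<Omega>')"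
proof -
  obtain \<phi> where \<phi>: "\<phi> \<in> iso (Gamma x0 G \<Omega>) (Gamma x0 G \<Omega>')" using iso unfolding is_iso_def by blast
  have mult: "f \<otimes>\<^bsub>Gamma x0 G \<Theta>\<^esub> g = f \<circ> g" for f g \<Theta>
    by (simp add: Gamma_def subgroup_generated_def)
  have "tower_iso (tower \<Omega>) (tower \<Omega>') \<phi>"
  proof (intro tower_iso.intro tower_iso_axioms.intro branch_tower_Gamma \<Omega>)
    show "bij_betw \<phi> (tower \<Omega> 0) (tower \<Omega>' 0)" unfolding tower_0 using \<phi> by (simp add: iso_def)
    show "\<phi> (g \<circ> h) = \<phi> g \<circ> \<phi> h" if "g \<in> tower \<Omega> 0" "h \<in> tower \<Omega> 0" for g h
      using \<phi> that unfolding tower_0 iso_def hom_def mult by simp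
    show "root_perm ` tower \<Omega> m = root_perm ` tower \<Omega>' m" for m
      unfolding tower_def root_perm_Gamma ..
  qed
  then interpret tower_iso "tower \<Omega>" "tower \<Omega>'" \<phi> .
  have "split_levels (tower \<Omega>' 0) ` tower \<Omega>' 0 = (\<lambda>c. split_levels (tower \<Omega>' 0) (\<phi> c)) ` tower \<Omega> 0"
    using bij_betw_imp_surj_on[OF bij_\<phi>] by (metis image_image)
  also have "\<dots> = split_levels (tower \<Omega> 0) ` tower \<Omega> 0"
    by (rule image_cong) (simp_all add: split_levels_image)
  finally show ?thesis unfolding tower_0 ..
qed

end

section \<open>Uncountably many isomorphism types\<close>

lemma uncountable_sets_of_nat: "uncountable (UNIV :: nat set set)"
proof
  assume "countable (UNIV :: nat set set)"
  then obtain f :: "nat \<Rightarrow> nat set" where "range f = UNIV"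
    by (metis UNIV_not_empty uncountable_def)
  then show False using Cantors_theorem[of UNIV] by (auto simp: Pow_UNIV)
qed

theorem corollary5p6:
  fixes x0 :: "'a::finite"
    and G :: "('a list \<Rightarrow> 'a list) set"
    and \<omega> :: "nat \<Rightarrow> 'a"
  assumes "subgroup G Aut_T"
    and "countable G"
    and "perfect_subgroup Aut_T G"
    and "self_similar G"
    and "property_H G"
    and "\<omega> \<in> seqs x0"
  shows "uncountable (iso_types ((\<lambda>\<omega>'. Gamma x0 G {\<omega>, \<omega>'}) ` seqs x0))"
proof
  interpret perfect_H_group x0 G
    using assms by (intro perfect_H_group.intro) (simp_all add: perfect_subgroup_def)
  let ?F = "(\<lambda>\<omega>'. Gamma x0 G {\<omega>, \<omega>'}) ` seqs x0"
  let ?levels = "\<lambda>H :: ('a list \<Rightarrow> 'a list) monoid. split_levels (carrier H) ` carrier H"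
  assume countable_types: "countable (iso_types ?F)"
  \<comment> \<open>One member represents each class, as the sets of split levels are the same for all of them.\<close>
  let ?some = "\<lambda>C :: ('a list \<Rightarrow> 'a list) monoid set. SOME H. H \<in> C"
  have some_in: "?some C \<in> C \<and> C \<subseteq> ?F" if "C \<in> iso_types ?F" for C
    using that unfolding iso_types_def
  proof (rule quotientE)
    fix H assume "H \<in> ?F" "C = {(H, K). H \<in> ?F \<and> K \<in> ?F \<and> H \<cong> K} `` {H}"
    then have "H \<in> C" "C \<subseteq> ?F" by auto
    then show ?thesis using someI[of "\<lambda>H. H \<in> C" H] by blast
  qed
  have countable_levels: "countable (?levels H)" if "H \<in> ?F" for H
    using that countable_Gamma[OF assms(2)] by auto
  have "countable (\<Union>C\<in>iso_types ?F. ?levels (?some C))"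
  proof (rule countable_UN[OF countable_types])
    fix C assume "C \<in> iso_types ?F"
    then have "?some C \<in> C" "C \<subseteq> ?F" using some_in by simp_all
    then show "countable (?levels (?some C))" by (intro countable_levels) (rule subsetD)
  qed
  moreover have "range ((`) Suc) \<subseteq> (\<Union>C\<in>iso_types ?F. ?levels (?some C))"
  proof (rule image_subsetI)
    fix E :: "nat set"
    obtain \<omega>1 where \<omega>1: "\<omega>1 \<in> seqs x0" "{k. \<omega> k = \<omega>1 k} = E"
      using prescribed_coincidences[OF assms(6)] by blast
    let ?H = "Gamma x0 G {\<omega>, \<omega>1}"
    let ?C = "{(H, K). H \<in> ?F \<and> K \<in> ?F \<and> H \<cong> K} `` {?H}"
    have H: "?H \<in> ?F" using \<omega>1(1) by blast
    then have C: "?C \<in> iso_types ?F" unfolding iso_types_def by (rule quotientI)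
    obtain K where K: "?some ?C = K" "K \<in> ?C" using some_in[OF C] by blast
    then have "K \<in> ?F" and iso: "?H \<cong> K" by simp_all
    then obtain \<omega>2 where \<omega>2: "\<omega>2 \<in> seqs x0" "K = Gamma x0 G {\<omega>, \<omega>2}" by blast
    have "?levels ?H = ?levels (?some ?C)"
      unfolding K(1) \<omega>2(2)
      by (rule split_levels_iso) (use iso[unfolded \<omega>2(2)] \<omega>1(1) \<omega>2(1) assms(6) in simp_all)
    moreover have "Suc ` E \<in> ?levels ?H"
      using split_levels_Gamma[OF assms(6) \<omega>1(1)] unfolding \<omega>1(2) by (metis imageI)
    ultimately have "Suc ` E \<in> ?levels (?some ?C)" by (simp only:)
    with C show "Suc ` E \<in> (\<Union>C\<in>iso_types ?F. ?levels (?some C))" by (rule UN_I)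
  qed
  ultimately have "countable (range ((`) Suc))" by (rule countable_subset[rotated])
  then have "countable (UNIV :: nat set set)"
    by (rule countable_image_inj_on) (simp add: inj_on_def inj_image_eq_iff)
  then show False using uncountable_sets_of_nat by simp
qed

end
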